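(* Let $P^X$, $\mu$, $\mathbf{P}^Y$ be the data of a Markov chain in a stationary random environment and let $\mathbf{P}_{z,y}$ be the associated quenched laws (all as defined in the context). Then the following are equivalent. 1. $\|\mathbf{P}_{z,y}(X_n \in \cdot) - \mathbf{P}_{z',y}(X_n \in \cdot)\|_{\mathrm{TV}} \to 0$ as $n\to\infty$ for $(\mu\otimes\mu)\mathbf{P}^Y$-a.e. $(z,z',y)$. 2. The tail $\sigma$-field $\mathcal{T}^X = \bigcap_{n\ge 0}\mathcal{F}^X_{[n,\infty[}$ is a.s. trivial in the following sense: there is a fixed set $H$ (independent of $A$) of $(\mu\otimes\mu)\mathbf{P}^Y$-full measure such that $$\mathbf{P}_{z,y}(A) = \mathbf{P}_{z,y}(A)^2 = \mathbf{P}_{z',y}(A)\qquad\text{for all } A\in\mathcal{T}^X \text{ and } (z,z',y)\in H.$$ 3. For $(\mu\otimes\mu)\mathbf{P}^Y$-a.e. $(z,z',y)$, there is an $n\in\mathbb{N}$ such that the measures $\mathbf{P}_{z,y}(X_n\in\cdot)$ and $\mathbf{P}_{z',y}(X_n\in\cdot)$ are not mutually singular.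
   Context: Let $E,F$ be Polish spaces, $\Omega^X=E^{\mathbb{Z}}$, $\Omega^Y=F^{\mathbb{Z}}$ with their Borel $\sigma$-fields, $X_n(x)=x(n)$, and let $\Theta$ be the shift, $(\Theta y)(m)=y(m+1)$. For $I\subset\mathbb{Z}$ set $\mathcal{F}^X_I=\sigma\{X_k:k\in I\}$, and $\mathcal{F}^X_+=\mathcal{F}^X_{[0,\infty[}$. $\mathcal{F}^Y$ denotes the Borel $\sigma$-field of $\Omega^Y$. The data of the model are: (i) a probability kernel $P^X:E\times\Omega^Y\times\mathcal{B}(E)\to[0,1]$; (ii) a probability kernel $\mu:\Omega^Y\times\mathcal{B}(E)\to[0,1]$ such that $\int P^X(z,y,A)\,\mu(y,dz)=\mu(\Theta y,A)$ for all $y\in\Omega^Y$, $A\in\mathcal{B}(E)$; (iii) a probability measure $\mathbf{P}^Y$ on $(\Omega^Y,\mathcal{F}^Y)$ invariant under $\Theta$. For $z\in E$, $y\in\Omega^Y$, $\mathbf{P}_{z,y}$ is the probability measure on $\mathcal{F}^X_+$ under which $(X_n)_{n\ge0}$ is the time-inhomogeneous Markov chain with $X_0=z$ and transition law of $X_{n+1}$ given $X_n$ equal to $P^X(X_n,\Theta^n y,\cdot)$, i.e. for $A\in\mathcal{F}^X_{[0,n]}$, $\mathbf{P}_{z,y}(A)=\int I_A(x)P^X(x(n-1),\Theta^{n-1}y,dx(n))\cdots P^X(x(0),y,dx(1))\,\delta_z(dx(0))$. The measure $(\mu\otimes\mu)\mathbf{P}^Y$ on $E\times E\times\Omega^Y$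 is $A\mapsto\int I_A(z,z',y)\,\mu(y,dz)\,\mu(y,dz')\,\mathbf{P}^Y(dy)$. The total variation norm is $\|\rho\|_{\mathrm{TV}}=\sup_{\|f\|_\infty\le1}|\int f\,d\rho|$. *)

theory Defs
  imports "HOL-Probability.Probability"
begin

definition path_shift :: "(int \<Rightarrow> 'f) \<Rightarrow> (int \<Rightarrow> 'f)" where
  "path_shift y = (\<lambda>m. y (m + 1))"

definition coord_field :: "int set \<Rightarrow> (int \<Rightarrow> 'e::topological_space) measure" where
  "coord_field I = sigma UNIV {(\<lambda>x. x k) -` B | k B. k \<in> I \<and> B \<in> sets borel}"

definition tail_field :: "(int \<Rightarrow> 'e::topological_space) set set" where
  "tail_field = (\<Inter>n::nat. sets (coord_field {int n..}))"

text \<open>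
  \<open>quenched_integral PX z y n f\<close> is the iterated integral of
  \<open>f x P\<^sup>X(x(n-1), \<Theta>\<^sup>n\<^sup>-\<^sup>1 y, dx(n)) \<dots> P\<^sup>X(x(0), y, dx(1)) \<delta>\<^sub>z(dx(0))\<close>.
  It is used only for \<open>f\<close> depending on \<open>x(0), \<dots>, x(n)\<close>; the constant path in the base
  case merely supplies a (then irrelevant) value for the remaining coordinates.
\<close>
primrec quenched_integral ::
  "('e \<Rightarrow> (int \<Rightarrow> 'f) \<Rightarrow> 'e measure) \<Rightarrow> 'e \<Rightarrow> (int \<Rightarrow> 'f) \<Rightarrow> nat \<Rightarrow> ((int \<Rightarrow> 'e) \<Rightarrow> ennreal) \<Rightarrow> ennreal"
where
  "quenched_integral PX z y 0 f = f (\<lambda>_. z)"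
| "quenched_integral PX z y (Suc n) f =
     quenched_integral PX z y n
       (\<lambda>x. \<integral>\<^sup>+ w. f (x(int (Suc n) := w)) \<partial>PX (x (int n)) ((path_shift ^^ n) y))"

definition is_quenched_law ::
  "('e::topological_space \<Rightarrow> (int \<Rightarrow> 'f) \<Rightarrow> 'e measure) \<Rightarrow> 'e \<Rightarrow> (int \<Rightarrow> 'f) \<Rightarrow> (int \<Rightarrow> 'e) measure \<Rightarrow> bool"
where
  "is_quenched_law PX z y Q \<longleftrightarrow>
     prob_space Q \<and> sets Q = sets (coord_field {0..}) \<and>
     (\<forall>n::nat. \<forall>A\<in>sets (coord_field {0..int n}).
        emeasure Q A = quenched_integral PX z y n (indicator A))"

text \<open>Existence and uniqueness are shown in \<open>is_quenched_law_quenched\<close> and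
  \<open>is_quenched_law_unique\<close> below.\<close>
definition quenched ::
  "('e::topological_space \<Rightarrow> (int \<Rightarrow> 'f) \<Rightarrow> 'e measure) \<Rightarrow> 'e \<Rightarrow> (int \<Rightarrow> 'f) \<Rightarrow> (int \<Rightarrow> 'e) measure"
where
  "quenched PX z y = (THE Q. is_quenched_law PX z y Q)"

definition quenched_marginal ::
  "('e::topological_space \<Rightarrow> (int \<Rightarrow> 'f) \<Rightarrow> 'e measure) \<Rightarrow> 'e \<Rightarrow> (int \<Rightarrow> 'f) \<Rightarrow> nat \<Rightarrow> 'e measure"
where
  "quenched_marginal PX z y n = distr (quenched PX z y) borel (\<lambda>x. x (int n))"

text \<open>The total variation norm of the signed measure \<open>M - N\<close>, where \<open>M\<close> and \<open>N\<close> are finite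
  measures on the same \<open>\<sigma>\<close>-field.\<close>
definition tv_norm_diff :: "'a measure \<Rightarrow> 'a measure \<Rightarrow> real" where
  "tv_norm_diff M N =
     (SUP f\<in>{f \<in> borel_measurable M. \<forall>x. \<bar>f x\<bar> \<le> (1::real)}.
        \<bar>(\<integral>x. f x \<partial>M) - (\<integral>x. f x \<partial>N)\<bar>)"

definition mutually_singular :: "'a measure \<Rightarrow> 'a measure \<Rightarrow> bool" where
  "mutually_singular M N \<longleftrightarrow>
     (\<exists>A\<in>sets M. emeasure M A = 0 \<and> emeasure N (space M - A) = 0)"

text \<open>The measure \<open>(\<mu> \<otimes> \<mu>) P\<^sup>Y\<close>; see \<open>emeasure_pair_mixture\<close> below for the integral formula.\<close>
definition pair_mixture ::
  "((int \<Rightarrow> 'f) \<Rightarrow> 'e measure) \<Rightarrow> (int \<Rightarrow> 'f::topological_space) measure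
     \<Rightarrow> ('e::topological_space \<times> 'e \<times> (int \<Rightarrow> 'f)) measure"
where
  "pair_mixture \<mu> PY =
     PY \<bind> (\<lambda>y. \<mu> y \<bind> (\<lambda>z'. \<mu> y \<bind> (\<lambda>z. return borel (z, z', y))))"

lemma emeasure_pair_mixture:
  fixes \<mu> :: "(int \<Rightarrow> 'f::polish_space) \<Rightarrow> 'e::polish_space measure"
  assumes mu[measurable]: "\<mu> \<in> borel \<rightarrow>\<^sub>M prob_algebra borel"
    and PY: "PY \<in> space (prob_algebra borel)"
    and A: "A \<in> sets borel"
  shows "emeasure (pair_mixture \<mu> PY) A =
    (\<integral>\<^sup>+ y. \<integral>\<^sup>+ z'. \<integral>\<^sup>+ z. indicator A (z, z', y) \<partial>\<mu> y \<partial>\<mu> y \<partial>PY)"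
proof -
  have mu': "\<mu> y \<in> space (prob_algebra borel)" for y
    by (rule measurable_space[OF mu]) simp
  have sets_mu[measurable_cong]: "sets (\<mu> y) = sets borel" for y
    using mu'[of y] by (simp add: space_prob_algebra)
  have sets_PY[measurable_cong]: "sets PY = sets borel"
    using PY by (simp add: space_prob_algebra)
  have triple: "(\<lambda>p. (snd p, snd (fst p), fst (fst p))) \<in>
      ((borel :: (int \<Rightarrow> 'f) measure) \<Otimes>\<^sub>M borel) \<Otimes>\<^sub>M borel \<rightarrow>\<^sub>M (borel :: ('e \<times> 'e \<times> (int \<Rightarrow> 'f)) measure)"
    unfolding borel_prod[symmetric] by measurable
  note R = measurable_compose[OF triple return_measurable, simplified]
  define K2 where "K2 p = \<mu> (fst p) \<bind> (\<lambda>z. return borel (z, snd p, fst p))"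
    for p :: "(int \<Rightarrow> 'f) \<times> 'e"
  have K2: "K2 \<in> borel \<Otimes>\<^sub>M borel \<rightarrow>\<^sub>M subprob_algebra borel"
    unfolding K2_def[abs_def]
    by (rule measurable_bind[where N=borel])
       (use R in \<open>auto intro!: measurable_prob_algebraD measurable_compose[OF measurable_fst mu] simp: split_beta'\<close>)
  define K1 where "K1 y = \<mu> y \<bind> (\<lambda>z'. K2 (y, z'))" for y
  have K1: "K1 \<in> borel \<rightarrow>\<^sub>M subprob_algebra borel"
    unfolding K1_def[abs_def]
    by (rule measurable_bind[where N=borel]) (use K2 measurable_prob_algebraD[OF mu] in auto)
  have pm: "pair_mixture \<mu> PY = PY \<bind> K1"
    by (simp add: pair_mixture_def K1_def[abs_def] K2_def)
  have e0: "emeasure (pair_mixture \<mu> PY) A = (\<integral>\<^sup>+ y. emeasure (K1 y) A \<partial>PY)"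
    unfolding pm using K1 A sets_eq_imp_space_eq[OF sets_PY]
    by (intro emeasure_bind[where N=borel]) (auto cong: measurable_cong_sets simp: sets_PY)
  have e1: "emeasure (K1 y) A = (\<integral>\<^sup>+ z'. emeasure (K2 (y, z')) A \<partial>\<mu> y)" for y
    unfolding K1_def using K2 A sets_eq_imp_space_eq[OF sets_mu]
    by (intro emeasure_bind[where N=borel])
       (auto cong: measurable_cong_sets simp: sets_mu intro!: measurable_compose[OF measurable_Pair1' K2])
  have e2: "emeasure (K2 (y, z')) A = (\<integral>\<^sup>+ z. indicator A (z, z', y) \<partial>\<mu> y)" for y z'
  proof -
    have "(\<lambda>z :: 'e. (z, z', y)) \<in> borel \<rightarrow>\<^sub>M borel"
      unfolding borel_prod[symmetric] by measurable
    then have "(\<lambda>z. return borel (z, z', y)) \<in> \<mu> y \<rightarrow>\<^sub>M subprob_algebra borel"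
      by (intro measurable_compose[OF _ return_measurable]) (simp cong: measurable_cong_sets add: sets_mu)
    then show ?thesis
      unfolding K2_def using A sets_eq_imp_space_eq[OF sets_mu]
      by (subst emeasure_bind[where N=borel]) auto
  qed
  show ?thesis by (simp add: e0 e1 e2)
qed

lemma space_coord_field [simp]: "space (coord_field I) = UNIV"
  by (simp add: coord_field_def)

lemma sets_coord_field:
  "sets (coord_field I) = sigma_sets UNIV {(\<lambda>x. x k) -` B | k B. k \<in> I \<and> B \<in> sets borel}"
  by (simp add: coord_field_def)

lemma measurable_coord [measurable (raw)]:
  "k \<in> I \<Longrightarrow> (\<lambda>x. x k) \<in> coord_field I \<rightarrow>\<^sub>M borel"
  by (rule measurableI) (auto simp: sets_coord_field intro!: sigma_sets.Basic)

lemma sets_coord_field_subset: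
  assumes "sigma_algebra UNIV S" "\<And>k B. k \<in> I \<Longrightarrow> B \<in> sets borel \<Longrightarrow> (\<lambda>x. x k) -` B \<in> S"
  shows "sets (coord_field I) \<subseteq> S"
  unfolding sets_coord_field
  by (rule sigma_algebra.sigma_sets_subset[OF assms(1)]) (use assms(2) in auto)

lemma sets_coord_field_mono: "I \<subseteq> J \<Longrightarrow> sets (coord_field I) \<subseteq> sets (coord_field J)"
  unfolding sets_coord_field by (rule sigma_sets_mono') blast

lemma is_quenched_law_unique:
  fixes Q Q' :: "(int \<Rightarrow> 'e::topological_space) measure"
  assumes "is_quenched_law PX z y Q" "is_quenched_law PX z y Q'"
  shows "Q = Q'"
proof (rule measure_eqI_generator_eq)
  let ?E = "\<Union>n::nat. sets (coord_field {0..int n}) :: (int \<Rightarrow> 'e) set set"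
  interpret Q: prob_space Q using assms by (simp add: is_quenched_law_def)
  show "Int_stable ?E"
  proof (rule Int_stableI)
    fix a b assume "a \<in> ?E" "b \<in> ?E"
    then obtain n m :: nat where "a \<in> sets (coord_field {0..int n})" "b \<in> sets (coord_field {0..int m})"
      by blast
    then have "a \<in> sets (coord_field {0..int (max n m)})" "b \<in> sets (coord_field {0..int (max n m)})"
      using sets_coord_field_mono[of "{0..int n}" "{0..int (max n m)}"]
        sets_coord_field_mono[of "{0..int m}" "{0..int (max n m)}"] by auto
    then have "a \<inter> b \<in> sets (coord_field {0..int (max n m)})" by (rule sets.Int)
    then show "a \<inter> b \<in> ?E" by blast
  qed
  show "?E \<subseteq> Pow UNIV" by simp
  show "emeasure Q X = emeasure Q' X" if "X \<in> ?E" for X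
    using assms that by (auto simp: is_quenched_law_def)
  have sub: "sets (coord_field {0..}) = sigma_sets UNIV ?E"
  proof
    have "(\<lambda>x. x k) -` B \<in> sigma_sets UNIV ?E" if "k \<in> {0..}" "B \<in> sets borel" for k and B :: "'e set"
    proof -
      have "(\<lambda>x. x k) -` B \<in> sets (coord_field {0..int (nat k)})"
        unfolding sets_coord_field using that by (intro sigma_sets.Basic) auto
      then show ?thesis by blast
    qed
    then show "sets (coord_field {0..}) \<subseteq> sigma_sets UNIV ?E"
      by (intro sets_coord_field_subset sigma_algebra_sigma_sets) auto
    have "?E \<subseteq> sets (coord_field {0..})"
      using sets_coord_field_mono[of "{0..int n}" "{0..}" for n] by auto
    then show "sigma_sets UNIV ?E \<subseteq> sets (coord_field {0..})"
      using sets.sigma_sets_subset[of ?E "coord_field {0..}"] by simp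
  qed
  show "sets Q = sigma_sets UNIV ?E" "sets Q' = sigma_sets UNIV ?E"
    using assms sub by (auto simp: is_quenched_law_def)
  show "range (\<lambda>_::nat. UNIV) \<subseteq> ?E" by (auto intro: sets.top[of "coord_field _", simplified])
  show "(\<Union>i::nat. UNIV) = (UNIV :: (int \<Rightarrow> 'e) set)" by simp
  show "emeasure Q UNIV \<noteq> \<infinity>" by simp
qed

lemma is_quenched_law_exists:
  fixes PX :: "'e::polish_space \<Rightarrow> (int \<Rightarrow> 'f::polish_space) \<Rightarrow> 'e measure"
  assumes PX: "(\<lambda>(z, y). PX z y) \<in> borel \<Otimes>\<^sub>M borel \<rightarrow>\<^sub>M prob_algebra borel"
  shows "\<exists>Q. is_quenched_law PX z y Q"
proof -
  let ?M = "\<lambda>_::nat. borel :: 'e measure"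
  define P where "P n \<omega> = (if n = 0 then return borel z else PX (\<omega> (n - 1)) ((path_shift ^^ (n - 1)) y))"
    for n and \<omega> :: "nat \<Rightarrow> 'e"
  have PXy: "(\<lambda>w. PX w y') \<in> borel \<rightarrow>\<^sub>M prob_algebra borel" for y'
    using measurable_compose[OF measurable_Pair2'[of y' borel borel] PX] by simp
  have PM: "P n \<in> PiM {0..<n} ?M \<rightarrow>\<^sub>M prob_algebra borel" for n
  proof (cases n)
    case 0
    then show ?thesis
      by (simp add: P_def[abs_def] space_prob_algebra prob_space_return)
  next
    case (Suc m)
    have "(\<lambda>\<omega>. \<omega> m) \<in> PiM {0..<n} ?M \<rightarrow>\<^sub>M borel"
      using Suc by (intro measurable_component_singleton) auto
    from measurable_compose[OF this PXy] show ?thesis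
      using Suc by (simp add: P_def[abs_def])
  qed
  interpret IT: Ionescu_Tulcea P ?M
  proof (rule Ionescu_Tulcea.intro)
    show "P i \<in> PiM {0..<i} ?M \<rightarrow>\<^sub>M subprob_algebra borel" for i
      by (rule measurable_prob_algebraD[OF PM])
    show "prob_space (P i x)" if "x \<in> space (PiM {0..<i} ?M)" for i x
      using measurable_space[OF PM that] by (simp add: space_prob_algebra)
  qed
  let ?u = "\<lambda>_::nat. undefined :: 'e"
  let ?r = "\<lambda>n (x :: int \<Rightarrow> 'e). restrict (\<lambda>i. x (int i)) {0..<Suc n}"
  have u: "?u \<in> space (PiM {0..<0} ?M)" by (simp add: space_PiM)
  have main: "(\<integral>\<^sup>+\<omega>. f \<omega> \<partial>IT.C 0 (Suc n) ?u) = quenched_integral PX z y n (\<lambda>x. f (?r n x))"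
    if "f \<in> borel_measurable (PiM {0..<Suc n} ?M)" for f n
    using that
  proof (induction n arbitrary: f)
    case 0
    have f[measurable]: "f \<in> borel_measurable (PiM {0..<Suc 0} ?M)" by (rule 0)
    have upd: "(\<lambda>w. ?u(0 := w)) \<in> borel \<rightarrow>\<^sub>M PiM {0..<Suc 0} ?M"
      by (rule measurable_fun_upd[where J="{}"]) (auto simp: space_PiM)
    have "(\<integral>\<^sup>+\<omega>. f \<omega> \<partial>IT.C 0 (Suc 0) ?u) = (\<integral>\<^sup>+\<omega>. f \<omega> \<partial>IT.eP 0 ?u)"
      using bind_return[OF IT.measurable_eP u] by simp
    also have "\<dots> = (\<integral>\<^sup>+w. f (?u(0 := w)) \<partial>P 0 ?u)"
      using u by (rule IT.nn_integral_eP) (use 0 in simp)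
    also have "\<dots> = f (?u(0 := z))"
      using measurable_compose[OF upd f]
      by (simp add: P_def nn_integral_return)
    also have "?u(0 := z) = ?r 0 (\<lambda>_. z)"
      by (auto simp: fun_eq_iff)
    finally show ?case by simp
  next
    case (Suc n)
    have f: "f \<in> borel_measurable (PiM {0..<Suc (Suc n)} ?M)" by (rule Suc.prems)
    let ?g = "\<lambda>\<omega>. \<integral>\<^sup>+\<omega>'. f \<omega>' \<partial>IT.eP (Suc n) \<omega>"
    have g: "?g \<in> borel_measurable (PiM {0..<Suc n} ?M)"
      by (rule measurable_compose[OF IT.measurable_eP nn_integral_measurable_subprob_algebra[OF f]])
    have eP: "IT.eP (Suc n) \<in> IT.C 0 (Suc n) ?u \<rightarrow>\<^sub>M subprob_algebra (PiM {0..<Suc (Suc n)} ?M)"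
      using IT.measurable_eP[of "Suc n"] IT.sets_C[OF u, of "Suc n"]
      by (simp cong: measurable_cong_sets)
    have "(\<integral>\<^sup>+\<omega>. f \<omega> \<partial>IT.C 0 (Suc (Suc n)) ?u) = (\<integral>\<^sup>+\<omega>. ?g \<omega> \<partial>IT.C 0 (Suc n) ?u)"
      using nn_integral_bind[OF f eP] by simp
    also have "\<dots> = quenched_integral PX z y n (\<lambda>x. ?g (?r n x))"
      by (rule Suc.IH[OF g])
    also have "(\<lambda>x. ?g (?r n x)) =
        (\<lambda>x. \<integral>\<^sup>+ w. f (?r (Suc n) (x(int (Suc n) := w))) \<partial>PX (x (int n)) ((path_shift ^^ n) y))"
    proof
      fix x :: "int \<Rightarrow> 'e"
      have "?g (?r n x) = (\<integral>\<^sup>+w. f ((?r n x)(Suc n := w)) \<partial>P (Suc n) (?r n x))"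
        by (rule IT.nn_integral_eP[OF _ f]) (auto simp: space_PiM)
      also have "P (Suc n) (?r n x) = PX (x (int n)) ((path_shift ^^ n) y)"
        by (simp add: P_def)
      also have "(\<lambda>w. (?r n x)(Suc n := w)) = (\<lambda>w. ?r (Suc n) (x(int (Suc n) := w)))"
        by (auto simp: fun_eq_iff less_Suc_eq)
      then have "(\<lambda>w. f ((?r n x)(Suc n := w))) = (\<lambda>w. f (?r (Suc n) (x(int (Suc n) := w))))"
        by metis
      finally show "?g (?r n x) =
        (\<integral>\<^sup>+ w. f (?r (Suc n) (x(int (Suc n) := w))) \<partial>PX (x (int n)) ((path_shift ^^ n) y))" .
    qed
    finally show ?case by (simp only: quenched_integral.simps)
  qed
  define e where "e = (\<lambda>(\<omega> :: nat \<Rightarrow> 'e) i. \<omega> (nat i))"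
  define Q where "Q = distr IT.PF.lim (coord_field {0..}) e"
  have e: "e \<in> IT.PF.lim \<rightarrow>\<^sub>M coord_field {0..}"
  proof -
    have "e \<in> PiM UNIV ?M \<rightarrow>\<^sub>M coord_field {0..}"
      unfolding coord_field_def
    proof (rule measurable_measure_of)
      fix S assume "S \<in> {(\<lambda>x. x k) -` B |k B. k \<in> {0::int..} \<and> B \<in> sets (borel :: 'e measure)}"
      then obtain k :: int and B :: "'e set" where S: "S = (\<lambda>x. x k) -` B" "B \<in> sets borel"
        by blast
      have "(\<lambda>\<omega>. \<omega> (nat k)) \<in> PiM UNIV ?M \<rightarrow>\<^sub>M borel"
        by (rule measurable_component_singleton) simp
      from measurable_sets[OF this S(2)] show "e -` S \<inter> space (PiM UNIV ?M) \<in> sets (PiM UNIV ?M)"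
        by (simp add: S e_def vimage_def)
    qed auto
    then show ?thesis by (simp cong: measurable_cong_sets)
  qed
  have "prob_space IT.PF.lim"
  proof (rule prob_space_distrD)
    show "(\<lambda>x. restrict x {}) \<in> IT.PF.lim \<rightarrow>\<^sub>M PiM {} ?M"
      by (simp add: measurable_cong_sets[OF IT.PF.sets_lim refl])
    show "prob_space (distr IT.PF.lim (PiM {} ?M) (\<lambda>x. restrict x {}))"
      by (subst IT.distr_lim) (auto intro: IT.PF.prob_space_P)
  qed
  then have "prob_space Q" unfolding Q_def using e by (rule prob_space.prob_space_distr)
  moreover have "sets Q = sets (coord_field {0..})" by (simp add: Q_def)
  moreover have "emeasure Q A = quenched_integral PX z y n (indicator A)"
    if A: "A \<in> sets (coord_field {0..int n})" for n :: nat and A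
  proof -
    let ?J = "{0..<Suc n}"
    have "sets (coord_field {0..int n}) \<subseteq> sets (vimage_algebra UNIV (?r n) (PiM ?J ?M))"
    proof (rule sets_coord_field_subset)
      show "sigma_algebra UNIV (sets (vimage_algebra UNIV (?r n) (PiM ?J ?M)))"
        using sets.sigma_algebra_axioms[of "vimage_algebra UNIV (?r n) (PiM ?J ?M)"] by simp
      fix k and B :: "'e set" assume k: "k \<in> {0..int n}" and B: "B \<in> sets borel"
      have "(\<lambda>\<omega>. \<omega> (nat k)) \<in> PiM ?J ?M \<rightarrow>\<^sub>M borel"
        using k by (intro measurable_component_singleton) auto
      from measurable_sets[OF this B]
      have "?r n -` ((\<lambda>\<omega>. \<omega> (nat k)) -` B \<inter> space (PiM ?J ?M)) \<inter> UNIV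
          \<in> sets (vimage_algebra UNIV (?r n) (PiM ?J ?M))"
        by (rule in_vimage_algebra)
      also have "?r n -` ((\<lambda>\<omega>. \<omega> (nat k)) -` B \<inter> space (PiM ?J ?M)) \<inter> UNIV = (\<lambda>x. x k) -` B"
        using k by (auto simp: space_PiM less_Suc_eq_le nat_le_iff)
      finally show "(\<lambda>x. x k) -` B \<in> sets (vimage_algebra UNIV (?r n) (PiM ?J ?M))" .
    qed
    then obtain B where B: "B \<in> sets (PiM ?J ?M)" and AB: "A = ?r n -` B"
      using A by (auto simp: sets_vimage_algebra2 space_PiM)
    have "A \<in> sets (coord_field {0..})"
      using A sets_coord_field_mono[of "{0..int n}" "{0..}"] by auto
    then have "emeasure Q A = emeasure IT.PF.lim (e -` A \<inter> space IT.PF.lim)"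
      unfolding Q_def by (rule emeasure_distr[OF e])
    also have "e -` A \<inter> space IT.PF.lim = IT.PF.emb UNIV ?J B"
      by (auto simp: AB e_def prod_emb_def space_PiM IT.PF.space_lim restrict_def cong: if_cong)
    also have "emeasure IT.PF.lim \<dots> = emeasure (IT.CI ?J) B"
      by (rule IT.lim[OF _ B]) simp
    also have "\<dots> = emeasure (IT.C 0 (Suc n) ?u) (IT.PF.emb ?J ?J B)"
      by (rule IT.emeasure_CI[OF _ B]) simp
    also have "IT.PF.emb ?J ?J B = B"
      using sets.sets_into_space[OF B] by (intro prod_emb_id) (simp add: space_PiM)
    also have "emeasure (IT.C 0 (Suc n) ?u) B = (\<integral>\<^sup>+\<omega>. indicator B \<omega> \<partial>IT.C 0 (Suc n) ?u)"
      using B IT.sets_C[OF u, of "Suc n"] by (intro nn_integral_indicator[symmetric]) simp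
    also have "\<dots> = quenched_integral PX z y n (\<lambda>x. indicator B (?r n x))"
      by (rule main) (use B in simp)
    also have "(\<lambda>x. indicator B (?r n x)) = (indicator A :: _ \<Rightarrow> ennreal)"
      by (auto simp: AB fun_eq_iff split: split_indicator)
    finally show ?thesis .
  qed
  ultimately show ?thesis unfolding is_quenched_law_def by blast
qed

lemma is_quenched_law_quenched:
  fixes PX :: "'e::polish_space \<Rightarrow> (int \<Rightarrow> 'f::polish_space) \<Rightarrow> 'e measure"
  assumes "(\<lambda>(z, y). PX z y) \<in> borel \<Otimes>\<^sub>M borel \<rightarrow>\<^sub>M prob_algebra borel"
  shows "is_quenched_law PX z y (quenched PX z y)"
  unfolding quenched_def
  by (rule theI') (use is_quenched_law_exists[OF assms, of z y] is_quenched_law_unique in blast)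

end

theory Submission
  imports Defs
begin

text \<open>
  Let \<open>\<beta>(z,z',y)\<close> be the decreasing limit of half the total variation distance of the time-\<open>n\<close>
  marginals. The two-point motion, in which two copies of the chain evolve independently in the same
  environment, is stationary under \<open>(\<mu> \<otimes> \<mu>) P\<^sup>Y\<close>, and \<open>\<beta>\<close> is a bounded submartingale along it;
  hence \<open>\<beta>\<close> is almost surely constant along its trajectories.

  If \<open>A\<close> is a tail event with \<open>P\<^bsub>z,y\<^esub>(A) > 0\<close> and \<open>P\<^bsub>z',y\<^esub>(A) < 1\<close>, Levy's zero-one law produces,
  with positive probability, states of the two copies from which the conditional probabilities of
  \<open>A\<close> are nearly 1 and nearly 0. There \<open>\<beta>\<close> is nearly 1, so \<open>\<beta>(z,z',y) = 1\<close> and all marginals are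
  mutually singular. Thus non-singularity forces a trivial tail. Conversely, if \<open>B\<^sub>n\<close> is a Hahn
  set for the marginals at time \<open>n\<close>, then the tail event \<open>limsup {X\<^sub>n \<in> B\<^sub>n}\<close> separates the two
  quenched laws by at least \<open>\<beta>\<close>, so that laws agreeing on the tail field merge.
\<close>

section \<open>Approximation and total variation\<close>

text \<open>One exceptional null set must serve all tail events, of which there are uncountably
  many. Arguments about a single event are therefore made for a fixed starting point
  \<open>(z, z', y)\<close>. Beyond the statement assumed, the only almost sure input is that
  \<beta> is constant under the \<open>n\<close>-step transitions for every \<open>n\<close>, a
  condition that mentions no event.

  This constancy comes from second moments: by stationarity \<beta>^2 has the same mean before and
  after a transition, and for a nonnegative submartingale the growth of that mean bounds the mean
  squared increment.

  The submartingale inequality uses only the marginals of the two copies. Independence enters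
  because two sets of states, each reached with positive probability by one copy, must be reached
  jointly with positive probability.

  Integrating \<beta> requires it to be measurable in the starting point although it is built from
  suprema over all Borel sets; regularity of Borel measures on Polish spaces reduces these to
  countable suprema.\<close>

lemma (in finite_measure) measure_approx_algebra:
  assumes G: "algebra (space M) G" and gen: "sets M = sigma_sets (space M) G"
    and A: "A \<in> sets M" and e: "0 < e"
  shows "\<exists>B\<in>G. measure M (sym_diff A B) < e"
proof -
  interpret G: algebra "space M" G by fact
  have GM: "G \<subseteq> sets M" unfolding gen by auto
  have "A \<in> sigma_sets (space M) G" using A gen by simp
  \<comment> \<open>All tolerances are treated at once because the union case uses the hypothesis
    with a smaller one.\<close>
  then have "\<forall>e>0. \<exists>B\<in>G. measure M (sym_diff A B) < e"
  proof (induction rule: sigma_sets.induct)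
    case (Basic A)
    then show ?case by (intro allI impI bexI[of _ A]) auto
  next
    case Empty
    then show ?case using G.empty_sets by (intro allI impI bexI[of _ "{}"]) auto
  next
    case (Compl A)
    show ?case
    proof (intro allI impI)
      fix e :: real assume "0 < e"
      then obtain B where B: "B \<in> G" "measure M (sym_diff A B) < e" using Compl by blast
      have "A \<subseteq> space M" using Compl(1) gen sets.sets_into_space by blast
      moreover have "B \<subseteq> space M" using B(1) GM sets.sets_into_space by blast
      ultimately have "sym_diff (space M - A) (space M - B) = sym_diff A B" by blast
      then show "\<exists>B\<in>G. measure M (sym_diff (space M - A) B) < e"
        using B by (intro bexI[of _ "space M - B"]) auto
    qed
  next
    case (Union a)
    have [measurable]: "a i \<in> sets M" for i using Union(1) gen by simp
    show ?case
    proof (intro allI impI)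
      fix e :: real assume e: "0 < e"
      have "(\<lambda>n. measure M (\<Union>i<n. a i)) \<longlonglongrightarrow> measure M (\<Union>n. \<Union>i<n. a i)"
        by (rule finite_Lim_measure_incseq) (auto simp: incseq_def intro: less_le_trans)
      moreover have "(\<Union>n. \<Union>i<n. a i) = (\<Union>i. a i)" by auto
      ultimately have "\<forall>\<^sub>F n in sequentially. measure M (\<Union>i. a i) - e / 2 < measure M (\<Union>i<n. a i)"
        using e by (intro order_tendstoD) auto
      then obtain n where "measure M (\<Union>i. a i) - e / 2 < measure M (\<Union>i<n. a i)"
        by (auto simp: eventually_sequentially)
      then have n: "measure M ((\<Union>i. a i) - (\<Union>i<n. a i)) < e / 2"
        by (subst finite_measure_Diff) auto
      \<comment> \<open>The \<open>n\<close> approximation errors add up to at most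
        \<open>e / 2\<close>, the other half being spent on truncating the union; the
        \<open>+ 1\<close> covers \<open>n = 0\<close>.\<close>
      define d where "d = e / (2 * (real n + 1))"
      have d: "0 < d" using e by (simp add: d_def)
      have "\<forall>i. \<exists>B\<in>G. measure M (sym_diff (a i) B) < d" using Union(2) d by blast
      then obtain B where B: "\<And>i. B i \<in> G" "\<And>i. measure M (sym_diff (a i) (B i)) < d" by metis
      have [measurable]: "B i \<in> sets M" for i using B(1) GM by blast
      have "measure M (sym_diff (\<Union>i. a i) (\<Union>i<n. B i))
          \<le> measure M (((\<Union>i. a i) - (\<Union>i<n. a i)) \<union> (\<Union>i<n. sym_diff (a i) (B i)))"
        by (intro finite_measure_mono) auto
      also have "\<dots> \<le> measure M ((\<Union>i. a i) - (\<Union>i<n. a i)) + measure M (\<Union>i<n. sym_diff (a i) (B i))"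
        by (rule measure_Un_le) auto
      also have "measure M (\<Union>i<n. sym_diff (a i) (B i)) \<le> (\<Sum>i<n. measure M (sym_diff (a i) (B i)))"
        by (rule finite_measure_subadditive_finite) auto
      also have "\<dots> \<le> (\<Sum>i<n. d)" using B(2) by (intro sum_mono less_imp_le) auto
      also have "\<dots> \<le> e / 2" using e by (simp add: d_def field_simps)
      finally have "measure M (sym_diff (\<Union>i. a i) (\<Union>i<n. B i)) < e" using n by simp
      then show "\<exists>B\<in>G. measure M (sym_diff (\<Union>i. a i) B) < e"
        using B(1) by (intro bexI[of _ "\<Union>i<n. B i"]) auto
    qed
  qed
  then show ?thesis using e by blast
qed

section \<open>Comparison of two probability measures\<close>

lemma nn_integral_mono_measure:
  assumes [measurable_cong]: "sets N = sets M"
    and le: "\<And>A. A \<in> sets M \<Longrightarrow> emeasure N A \<le> emeasure M A"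
    and f: "f \<in> borel_measurable M"
  shows "(\<integral>\<^sup>+x. f x \<partial>N) \<le> (\<integral>\<^sup>+x. f x \<partial>M)"
  using f
proof (induction rule: borel_measurable_induct)
  case (cong f g)
  then show ?case using sets_eq_imp_space_eq[OF assms(1)]
    by (metis (no_types, lifting) nn_integral_cong)
next
  case (set A)
  then show ?case using le[of A] assms(1) by simp
next
  case (mult u c)
  then show ?case by (auto simp: nn_integral_cmult intro!: mult_left_mono)
next
  case (add u v)
  then show ?case by (auto simp: nn_integral_add intro!: add_mono)
next
  case (seq U)
  have "(\<integral>\<^sup>+x. (SUP i. U i) x \<partial>N) = (SUP i. \<integral>\<^sup>+x. U i x \<partial>N)"
    using seq unfolding SUP_apply by (intro nn_integral_monotone_convergence_SUP) auto
  also have "\<dots> \<le> (SUP i. \<integral>\<^sup>+x. U i x \<partial>M)"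
    using seq by (intro SUP_mono) blast
  also have "\<dots> = (\<integral>\<^sup>+x. (SUP i. U i) x \<partial>M)"
    using seq unfolding SUP_apply by (intro nn_integral_monotone_convergence_SUP[symmetric]) auto
  finally show ?case by (simp add: image_comp)
qed

text \<open>Half the total variation norm of the difference when both are probability measures. No
  absolute value is taken: passing to the complement changes the sign of the difference.\<close>

definition set_gap :: "'a measure \<Rightarrow> 'a measure \<Rightarrow> real" where
  "set_gap M N = (SUP A\<in>sets M. measure M A - measure N A)"

lemma bdd_above_set_gap:
  assumes "prob_space M" "prob_space N"
  shows "bdd_above ((\<lambda>A. measure M A - measure N A) ` S)"
proof (rule bdd_aboveI2)
  fix A show "measure M A - measure N A \<le> 1"
    using prob_space.prob_le_1[OF assms(1), of A] measure_nonneg[of N A] by linarith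
qed

lemma set_gap_upper:
  assumes "prob_space M" "prob_space N" "A \<in> sets M"
  shows "measure M A - measure N A \<le> set_gap M N"
  unfolding set_gap_def by (rule cSUP_upper[OF assms(3) bdd_above_set_gap[OF assms(1,2)]])

lemma set_gap_nonneg:
  assumes "prob_space M" "prob_space N"
  shows "0 \<le> set_gap M N"
  using set_gap_upper[OF assms, of "{}"] by simp

lemma set_gap_le_1:
  assumes "prob_space M" "prob_space N"
  shows "set_gap M N \<le> 1"
  unfolding set_gap_def
proof (rule cSUP_least)
  fix A show "measure M A - measure N A \<le> 1"
    using prob_space.prob_le_1[OF assms(1), of A] measure_nonneg[of N A] by linarith
qed auto

text \<open>A test function with values in [0,1] differs from the indicator of the Hahn set
  \<open>Y\<close> by a deficit on \<open>Y\<close>, where \<open>M\<close> dominates, and an excess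
  off \<open>Y\<close>, where \<open>N\<close> dominates. Both lower the difference of the
  integrals, so the supremum over sets is attained at \<open>Y\<close> and also bounds all such
  functions.\<close>

lemma set_gap_Hahn:
  fixes M N :: "'a measure"
  assumes M: "prob_space M" and N: "prob_space N" and sets[measurable_cong]: "sets N = sets M"
  obtains Y where "Y \<in> sets M" "measure M Y - measure N Y = set_gap M N"
    "\<And>f. f \<in> borel_measurable M \<Longrightarrow> (\<And>x. 0 \<le> f x) \<Longrightarrow> (\<And>x. f x \<le> 1) \<Longrightarrow>
      (\<integral>x. f x \<partial>M) - (\<integral>x. f x \<partial>N) \<le> set_gap M N"
proof -
  interpret M: prob_space M by fact
  interpret N: prob_space N by fact
  note sp = sets_eq_imp_space_eq[OF sets]
  obtain Y where [measurable]: "Y \<in> sets M"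
    and Y1: "\<And>X. X \<in> sets M \<Longrightarrow> X \<subseteq> Y \<Longrightarrow> emeasure N X \<le> emeasure M X"
    and Y2: "\<And>X. X \<in> sets M \<Longrightarrow> X \<inter> Y = {} \<Longrightarrow> emeasure M X \<le> emeasure N X"
    using finite_unsigned_Hahn_decomposition[OF M.finite_measure_axioms N.finite_measure_axioms sets]
    by metis
  \<comment> \<open>Domination is known only for subsets of \<open>Z\<close>. Passing to the
    densities with respect to \<open>indicator Z\<close> makes it hold for all measurable sets, so
    that \<open>nn_integral_mono_measure\<close> applies.\<close>
  have le: "(\<integral>x. g x * indicator Z x \<partial>Q) \<le> (\<integral>x. g x * indicator Z x \<partial>R)"
    if Q: "prob_space Q" and R: "prob_space R" and sQ[measurable_cong]: "sets Q = sets M"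
      and sR[measurable_cong]: "sets R = sets M" and [measurable]: "Z \<in> sets M"
      and le: "\<And>X. X \<in> sets M \<Longrightarrow> X \<subseteq> Z \<Longrightarrow> emeasure Q X \<le> emeasure R X"
      and [measurable]: "g \<in> borel_measurable M" and g: "\<And>x. 0 \<le> g x" "\<And>x. g x \<le> 1"
    for Q R Z and g :: "'a \<Rightarrow> real"
  proof -
    interpret Q: prob_space Q by fact
    interpret R: prob_space R by fact
    have "(\<integral>\<^sup>+x. ennreal (g x) \<partial>density Q (indicator Z)) \<le> (\<integral>\<^sup>+x. ennreal (g x) \<partial>density R (indicator Z))"
    proof (rule nn_integral_mono_measure)
      fix A assume "A \<in> sets (density R (indicator Z))"
      then have [measurable]: "A \<in> sets M" by (simp add: sR)
      have "emeasure Q (Z \<inter> A) \<le> emeasure R (Z \<inter> A)" by (rule le) auto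
      then show "emeasure (density Q (indicator Z)) A \<le> emeasure (density R (indicator Z)) A"
        by (simp add: emeasure_density nn_integral_indicator sQ sR flip: indicator_inter_arith)
    qed (auto simp: sQ sR)
    then have "(\<integral>\<^sup>+x. ennreal (g x * indicator Z x) \<partial>Q) \<le> (\<integral>\<^sup>+x. ennreal (g x * indicator Z x) \<partial>R)"
      by (simp add: nn_integral_density ennreal_mult'' ennreal_indicator mult.commute)
    moreover have "integrable Q (\<lambda>x. g x * indicator Z x)" "integrable R (\<lambda>x. g x * indicator Z x)"
      using g by (auto intro!: Q.integrable_const_bound[where B=1] R.integrable_const_bound[where B=1] AE_I2
          simp: indicator_def)
    ultimately have "ennreal (\<integral>x. g x * indicator Z x \<partial>Q) \<le> ennreal (\<integral>x. g x * indicator Z x \<partial>R)"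
      using g by (simp add: nn_integral_eq_integral)
    then show ?thesis using g by (subst (asm) ennreal_le_iff) (auto intro!: integral_nonneg_AE)
  qed
  have key: "(\<integral>x. f x \<partial>M) - (\<integral>x. f x \<partial>N) \<le> measure M Y - measure N Y"
    if [measurable]: "f \<in> borel_measurable M" and f: "\<And>x. 0 \<le> f x" "\<And>x. f x \<le> 1" for f
  proof -
    have int: "integrable M (\<lambda>x. f x * indicator Z x)" "integrable N (\<lambda>x. f x * indicator Z x)"
      "integrable M (\<lambda>x. (1 - f x) * indicator Z x)" "integrable N (\<lambda>x. (1 - f x) * indicator Z x)"
      if [measurable]: "Z \<in> sets M" for Z
      using f by (auto intro!: M.integrable_const_bound[where B=1] N.integrable_const_bound[where B=1] AE_I2
          simp: indicator_def)
    have int_Y: "integrable M (indicator Y :: _ \<Rightarrow> real)" "integrable N (indicator Y :: _ \<Rightarrow> real)"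
      by (auto intro!: M.integrable_const_bound[where B=1] N.integrable_const_bound[where B=1])
    \<comment> \<open>The identity f = 1_Y - (1 - f) 1_Y + f 1_{Y^c}, integrated: the last two terms
      are the deficit and the excess relative to the Hahn set.\<close>
    have split: "(\<integral>x. f x \<partial>Q) = measure Q Y - (\<integral>x. (1 - f x) * indicator Y x \<partial>Q)
        + (\<integral>x. f x * indicator (space M - Y) x \<partial>Q)" if Q: "Q = M \<or> Q = N" for Q
    proof -
      have "(\<integral>x. f x \<partial>Q) = (\<integral>x. (indicator Y x - (1 - f x) * indicator Y x)
          + f x * indicator (space M - Y) x \<partial>Q)"
        using Q sp by (intro Bochner_Integration.integral_cong) (auto simp: indicator_def)
      also have "\<dots> = (\<integral>x. (indicator Y x - (1 - f x) * indicator Y x) \<partial>Q)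
          + (\<integral>x. f x * indicator (space M - Y) x \<partial>Q)"
        using Q int int_Y by (intro Bochner_Integration.integral_add Bochner_Integration.integrable_diff)
          (auto simp: sets)
      also have "(\<integral>x. (indicator Y x - (1 - f x) * indicator Y x) \<partial>Q)
          = measure Q Y - (\<integral>x. (1 - f x) * indicator Y x \<partial>Q)"
        using Q int int_Y by (subst Bochner_Integration.integral_diff) (auto simp: sets)
      finally show ?thesis .
    qed
    have "(\<integral>x. (1 - f x) * indicator Y x \<partial>N) \<le> (\<integral>x. (1 - f x) * indicator Y x \<partial>M)"
      using Y1 f by (intro le) (auto simp: M N sets)
    moreover have "(\<integral>x. f x * indicator (space M - Y) x \<partial>M) \<le> (\<integral>x. f x * indicator (space M - Y) x \<partial>N)"
      using Y2 f by (intro le) (auto simp: M N sets)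
    ultimately show ?thesis using split[of M] split[of N] by simp
  qed
  have eq: "measure M Y - measure N Y = set_gap M N"
  proof (rule antisym)
    show "measure M Y - measure N Y \<le> set_gap M N" by (rule set_gap_upper) (auto simp: M N)
    have "measure M A - measure N A \<le> measure M Y - measure N Y" if "A \<in> sets M" for A
      using key[of "indicator A"] that by (simp add: sets)
    then show "set_gap M N \<le> measure M Y - measure N Y"
      unfolding set_gap_def by (intro cSUP_least) auto
  qed
  show thesis by (rule that[OF \<open>Y \<in> sets M\<close> eq key[unfolded eq]])
qed

lemma integral_diff_le_set_gap:
  assumes "prob_space M" "prob_space N" "sets N = sets M"
    and "f \<in> borel_measurable M" "\<And>x. 0 \<le> f x" "\<And>x. f x \<le> 1"
  shows "(\<integral>x. f x \<partial>M) - (\<integral>x. f x \<partial>N) \<le> set_gap M N"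
proof (rule set_gap_Hahn[OF assms(1-3)])
  assume le: "\<And>f. f \<in> borel_measurable M \<Longrightarrow> (\<And>x. 0 \<le> f x) \<Longrightarrow> (\<And>x. f x \<le> 1) \<Longrightarrow>
    (\<integral>x. f x \<partial>M) - (\<integral>x. f x \<partial>N) \<le> set_gap M N"
  show ?thesis by (rule le) (fact assms)+
qed

text \<open>The map t -> (1 + t) / 2 carries test functions with values in [-1,1] to values in [0,1]
  and halves differences of integrals, whence the factor 2. The sign function of the Hahn set
  attains the bound.\<close>

lemma tv_norm_diff_eq_set_gap:
  assumes M: "prob_space M" and N: "prob_space N" and sets[measurable_cong]: "sets N = sets M"
  shows "tv_norm_diff M N = 2 * set_gap M N"
proof -
  interpret M: prob_space M by fact
  interpret N: prob_space N by fact
  let ?F = "{f \<in> borel_measurable M. \<forall>x. \<bar>f x\<bar> \<le> (1::real)}"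
  have one: "(\<integral>x. f x \<partial>M) - (\<integral>x. f x \<partial>N) \<le> 2 * set_gap M N" if "f \<in> ?F" for f
  proof -
    have [measurable]: "f \<in> borel_measurable M" and f: "\<bar>f x\<bar> \<le> 1" for x using that by auto
    have "integrable M f" "integrable N f"
      using f by (auto intro!: M.integrable_const_bound[where B=1] N.integrable_const_bound[where B=1])
    moreover have "(\<integral>x. (1 + f x) / 2 \<partial>M) - (\<integral>x. (1 + f x) / 2 \<partial>N) \<le> set_gap M N"
      using f by (intro integral_diff_le_set_gap[OF M N sets]) (auto, (smt (verit) f)+)
    ultimately show ?thesis by (simp add: M.prob_space N.prob_space field_simps)
  qed
  have upper: "\<bar>(\<integral>x. f x \<partial>M) - (\<integral>x. f x \<partial>N)\<bar> \<le> 2 * set_gap M N" if "f \<in> ?F" for f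
    using one[OF that] one[of "\<lambda>x. - f x"] that by (simp add: abs_le_iff)
  obtain Y where [measurable]: "Y \<in> sets M" and Y: "measure M Y - measure N Y = set_gap M N"
    by (rule set_gap_Hahn[OF M N sets])
  let ?f = "\<lambda>x. 2 * indicator Y x - 1 :: real"
  have "?f \<in> ?F" by (auto simp: indicator_def)
  have "(\<integral>x. ?f x \<partial>M) - (\<integral>x. ?f x \<partial>N) = 2 * set_gap M N"
  proof -
    have "integrable M (indicator Y :: _ \<Rightarrow> real)" "integrable N (indicator Y :: _ \<Rightarrow> real)"
      by (auto intro!: M.integrable_const_bound[where B=1] N.integrable_const_bound[where B=1])
    then show ?thesis using Y by (simp add: M.prob_space N.prob_space sets)
  qed
  then have "2 * set_gap M N \<le> \<bar>(\<integral>x. ?f x \<partial>M) - (\<integral>x. ?f x \<partial>N)\<bar>" by simp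
  also have "\<dots> \<le> tv_norm_diff M N"
    unfolding tv_norm_diff_def using upper
    by (intro cSUP_upper[OF \<open>?f \<in> ?F\<close>] bdd_aboveI2) auto
  finally have "2 * set_gap M N \<le> tv_norm_diff M N" .
  moreover have "tv_norm_diff M N \<le> 2 * set_gap M N"
    unfolding tv_norm_diff_def using upper \<open>?f \<in> ?F\<close> by (intro cSUP_least) blast+
  ultimately show ?thesis by simp
qed

text \<open>Because the gap is attained, the value 1 is realised by an actual set \<open>Y\<close>,
  which must have full \<open>M\<close>-mass and zero \<open>N\<close>-mass.\<close>

lemma mutually_singular_iff_set_gap:
  assumes M: "prob_space M" and N: "prob_space N" and sets: "sets N = sets M"
  shows "mutually_singular M N \<longleftrightarrow> set_gap M N = 1"
proof
  interpret M: prob_space M by fact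
  interpret N: prob_space N by fact
  assume "mutually_singular M N"
  then obtain A where A: "A \<in> sets M" "emeasure M A = 0" "emeasure N (space M - A) = 0"
    by (auto simp: mutually_singular_def)
  then have "measure M A = 0" "measure N (space M - A) = 0"
    by (simp_all add: measure_def)
  then have "measure M (space M - A) = 1" "measure N (space M - A) = 0"
    using M.prob_compl[OF A(1)] by simp_all
  then have "1 \<le> set_gap M N"
    using set_gap_upper[OF M N, of "space M - A"] A by simp
  then show "set_gap M N = 1" using set_gap_le_1[OF M N] by simp
next
  interpret M: prob_space M by fact
  interpret N: prob_space N by fact
  assume gap: "set_gap M N = 1"
  obtain Y where Y: "Y \<in> sets M" "measure M Y - measure N Y = 1"
    by (rule set_gap_Hahn[OF M N sets, unfolded gap])
  have "measure M Y = 1" "measure N Y = 0"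
    using Y(2) M.prob_le_1[of Y] measure_nonneg[of N Y] by linarith+
  then have "measure M (space M - Y) = 0" "measure N Y = 0"
    using Y by (simp_all add: M.prob_compl)
  then show "mutually_singular M N"
    unfolding mutually_singular_def using Y sets.sets_into_space[OF Y(1)]
    by (intro bexI[of _ "space M - Y"]) (auto simp: M.emeasure_eq_measure N.emeasure_eq_measure double_diff)
qed

text \<open>The family does not depend on the two measures, so the gap of two kernels is a countable
  supremum of measurable functions. Finite unions of basic open sets suffice: Borel sets are
  approximated by open ones from outside, and open sets by such unions from inside.\<close>

lemma set_gap_countable:
  "\<exists>\<U>::'a::polish_space set set. countable \<U> \<and> \<U> \<noteq> {} \<and> \<U> \<subseteq> sets borel \<and>
    (\<forall>M N. prob_space M \<longrightarrow> prob_space N \<longrightarrow> sets M = sets borel \<longrightarrow> sets N = sets borel \<longrightarrow>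
      set_gap M N = (SUP U\<in>\<U>. measure M U - measure N U))"
proof -
  obtain B :: "'a set set" where B: "countable B" "topological_basis B"
    using ex_countable_basis by blast
  let ?\<U> = "Union ` {F. finite F \<and> F \<subseteq> B}"
  have sub: "?\<U> \<subseteq> sets borel"
    using B(2) by (auto simp: topological_basis_def intro!: borel_open open_Union)
  have "set_gap M N = (SUP U\<in>?\<U>. measure M U - measure N U)"
    if M: "prob_space M" and N: "prob_space N" and sM: "sets M = sets borel" and sN: "sets N = sets borel"
    for M N :: "'a measure"
  proof -
    interpret M: prob_space M by fact
    interpret N: prob_space N by fact
    let ?s = "SUP U\<in>?\<U>. measure M U - measure N U"
    have le: "?s \<le> set_gap M N"
    proof (rule cSUP_least)
      show "?\<U> \<noteq> {}" by (auto intro!: exI[of _ "{}"])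
      show "measure M U - measure N U \<le> set_gap M N" if "U \<in> ?\<U>" for U
        using sub that sM by (intro set_gap_upper[OF M N]) blast
    qed
    have ge: "measure M A - measure N A \<le> ?s" if A: "A \<in> sets M" for A
    proof (rule field_le_epsilon)
      fix e :: real assume e: "0 < e"
      \<comment> \<open>Only \<open>N\<close> has to be controlled: enlarging \<open>A\<close> to an
        open \<open>U\<close> can only increase the \<open>M\<close>-term, which enters with a
        positive sign.\<close>
      have "emeasure N A = (INF U\<in>{U. A \<subseteq> U \<and> open U}. emeasure N U)"
        by (rule outer_regular) (use A sM sN N.emeasure_finite in auto)
      then have "\<exists>U\<in>{U. A \<subseteq> U \<and> open U}. emeasure N U < emeasure N A + ennreal e"
        using e by (subst INF_less_iff[symmetric]) (auto simp: N.emeasure_eq_measure ennreal_plus[symmetric] simp del: ennreal_plus intro!: ennreal_lessI add_nonneg_pos)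
      then obtain U where U: "A \<subseteq> U" "open U" "emeasure N U < emeasure N A + ennreal e" by blast
      then have NU: "measure N U < measure N A + e"
        using e by (simp add: N.emeasure_eq_measure ennreal_less_iff flip: ennreal_plus)
      have MU: "measure M A \<le> measure M U"
        using U sM by (intro M.finite_measure_mono) auto
      obtain B' where B': "B' \<subseteq> B" "\<Union>B' = U"
        using B(2) U(2) by (auto simp: topological_basis_def)
      \<comment> \<open>The empty set is added so that an enumeration by naturals exists even for
        empty \<open>B'\<close>. It need not belong to the basis and is removed again in
        \<open>V\<close>.\<close>
      have "countable (insert {} B')"
        using B(1) B'(1) countable_subset by blast
      then obtain b :: "nat \<Rightarrow> 'a set" where b: "range b = insert {} B'"
        using range_from_nat_into[of "insert {} B'"] by (metis insert_not_empty)
      define V where "V n = \<Union>(b ` {..<n} - {{}})" for n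
      have V: "V n \<in> ?\<U>" for n
      proof -
        have "b ` {..<n} - {{}} \<subseteq> B" using b B'(1) by blast
        then show ?thesis unfolding V_def by (intro imageI) auto
      qed
      have inc: "incseq V" by (force simp: incseq_def V_def)
      have VU: "(\<Union>n. V n) = U"
      proof -
        have "(\<Union>n. V n) = \<Union>(range b)" by (auto simp: V_def)
        then show ?thesis using b B'(2) by simp
      qed
      have rV: "range V \<subseteq> sets M" "range V \<subseteq> sets N"
        unfolding sM sN using V sub by blast+
      have "(\<lambda>n. measure M (V n) - measure N (V n)) \<longlonglongrightarrow> measure M U - measure N U"
        unfolding VU[symmetric]
        by (intro tendsto_diff M.finite_Lim_measure_incseq N.finite_Lim_measure_incseq rV inc)
      then have "measure M U - measure N U \<le> ?s"
        by (rule LIMSEQ_le_const2) (intro exI[of _ 0] allI impI cSUP_upper V bdd_above_set_gap[OF M N])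
      then show "measure M A - measure N A \<le> ?s + e" using NU MU by linarith
    qed
    have "set_gap M N \<le> ?s"
      unfolding set_gap_def using ge by (intro cSUP_least) auto
    then show ?thesis using le by (rule antisym)
  qed
  moreover have "countable ?\<U>" using countable_Collect_finite_subset[OF B(1)] by blast
  moreover have "?\<U> \<noteq> {}" by (auto intro!: exI[of _ "{}"])
  ultimately show ?thesis using sub by blast
qed

lemma measurable_set_gap [measurable (raw)]:
  fixes p q :: "'b \<Rightarrow> 'a::polish_space measure"
  assumes p: "p \<in> M \<rightarrow>\<^sub>M prob_algebra borel" and q: "q \<in> M \<rightarrow>\<^sub>M prob_algebra borel"
  shows "(\<lambda>x. set_gap (p x) (q x)) \<in> borel_measurable M"
proof -
  obtain \<U> :: "'a set set" where U: "countable \<U>" "\<U> \<noteq> {}" "\<U> \<subseteq> sets borel"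
    and eq: "\<And>M N. prob_space M \<Longrightarrow> prob_space N \<Longrightarrow> sets M = sets borel \<Longrightarrow> sets N = sets borel \<Longrightarrow>
      set_gap M N = (SUP U\<in>\<U>. measure M U - measure N U)"
    using set_gap_countable by metis
  have pq: "prob_space (p x)" "prob_space (q x)" "sets (p x) = sets borel" "sets (q x) = sets borel"
    if "x \<in> space M" for x
    using measurable_space[OF p that] measurable_space[OF q that] by (auto simp: space_prob_algebra)
  have "(\<lambda>x. SUP U\<in>\<U>. measure (p x) U - measure (q x) U) \<in> borel_measurable M"
  proof (rule borel_measurable_cSUP[OF U(1)])
    fix A assume "A \<in> \<U>"
    then have "A \<in> sets borel" using U by blast
    then show "(\<lambda>x. measure (p x) A - measure (q x) A) \<in> borel_measurable M"
      using p q by (intro borel_measurable_diff measurable_compose[OF _ measurable_measure_prob_algebra])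
  qed (use pq in \<open>auto intro: bdd_above_set_gap\<close>)
  then show ?thesis by (rule measurable_cong[THEN iffD1, rotated]) (use pq eq in auto)
qed

section \<open>The Markov property of the quenched laws\<close>

lemma coord_field_agree:
  assumes "A \<in> sets (coord_field I)" "\<And>k. k \<in> I \<Longrightarrow> x k = x' k"
  shows "x \<in> A \<longleftrightarrow> x' \<in> A"
  using assms(1) unfolding sets_coord_field
  by (induction rule: sigma_sets.induct) (auto simp: assms(2))

lemma coord_field_fun_agree:
  fixes f :: "(int \<Rightarrow> 'e::topological_space) \<Rightarrow> 'b::t1_space"
  assumes f: "f \<in> borel_measurable (coord_field I)" and "\<And>k. k \<in> I \<Longrightarrow> x k = x' k"
  shows "f x = f x'"
proof -
  have "f -` {f x} \<inter> space (coord_field I) \<in> sets (coord_field I)"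
    by (rule measurable_sets[OF f]) simp
  then have "x \<in> f -` {f x} \<inter> UNIV \<longleftrightarrow> x' \<in> f -` {f x} \<inter> UNIV"
    by (intro coord_field_agree[OF _ assms(2)]) auto
  then show ?thesis by simp
qed

lemma measurable_coord_fieldI:
  fixes g :: "'a \<Rightarrow> int \<Rightarrow> 'e::topological_space"
  assumes "\<And>k. k \<in> I \<Longrightarrow> (\<lambda>x. g x k) \<in> M \<rightarrow>\<^sub>M borel"
  shows "g \<in> M \<rightarrow>\<^sub>M coord_field I"
  unfolding coord_field_def
proof (rule measurable_measure_of)
  fix S :: "(int \<Rightarrow> 'e) set" assume "S \<in> {(\<lambda>x. x k) -` B |k B. k \<in> I \<and> B \<in> sets borel}"
  then obtain k B where S: "S = (\<lambda>x. x k) -` B" "k \<in> I" "B \<in> sets borel" by blast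
  have "g -` S \<inter> space M = (\<lambda>x. g x k) -` B \<inter> space M" by (auto simp: S)
  also have "\<dots> \<in> sets M" using assms[OF S(2)] S(3) by (rule measurable_sets)
  finally show "g -` S \<inter> space M \<in> sets M" .
qed auto

lemma measurable_coord_field_comp:
  assumes "\<And>k. k \<in> I \<Longrightarrow> h k \<in> J"
  shows "(\<lambda>x k. x (h k)) \<in> coord_field J \<rightarrow>\<^sub>M coord_field I"
  by (intro measurable_coord_fieldI measurable_coord assms)

lemma algebra_coord_field_union:
  "algebra UNIV (\<Union>n::nat. sets (coord_field {0..int n} :: (int \<Rightarrow> 'e::topological_space) measure))"
proof (intro algebra.intro ring_of_setsI algebra_axioms.intro)
  let ?E = "\<Union>n::nat. sets (coord_field {0..int n}) :: (int \<Rightarrow> 'e) set set"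
  show "{} \<in> ?E" "UNIV \<in> ?E"
    using sets.top[of "coord_field _ :: (int \<Rightarrow> 'e) measure"] by auto
  fix a b assume "a \<in> ?E" "b \<in> ?E"
  then obtain n m :: nat where "a \<in> sets (coord_field {0..int n})" "b \<in> sets (coord_field {0..int m})"
    by blast
  then have ab: "a \<in> sets (coord_field {0..int (max n m)})" "b \<in> sets (coord_field {0..int (max n m)})"
    using sets_coord_field_mono[of "{0..int n}" "{0..int (max n m)}"]
      sets_coord_field_mono[of "{0..int m}" "{0..int (max n m)}"] by auto
  show "a \<union> b \<in> ?E" "a - b \<in> ?E"
    using sets.Un[OF ab] sets.Diff[OF ab] by blast+
qed auto

lemma sets_coord_field_generated:
  "sets (coord_field {0..} :: (int \<Rightarrow> 'e::topological_space) measure) = sigma_sets UNIV (\<Union>n::nat. sets (coord_field {0..int n}))"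
proof
  let ?E = "\<Union>n::nat. sets (coord_field {0..int n}) :: (int \<Rightarrow> 'e) set set"
  have "(\<lambda>x. x k) -` B \<in> sigma_sets UNIV ?E" if "k \<in> {0..}" "B \<in> sets borel" for k and B :: "'e set"
  proof -
    have "(\<lambda>x. x k) -` B \<in> sets (coord_field {0..int (nat k)})"
      unfolding sets_coord_field using that by (intro sigma_sets.Basic) auto
    then show ?thesis by blast
  qed
  then show "sets (coord_field {0..}) \<subseteq> sigma_sets UNIV ?E"
    by (intro sets_coord_field_subset sigma_algebra_sigma_sets) auto
  have "?E \<subseteq> sets (coord_field {0..})"
    using sets_coord_field_mono[of "{0..int n}" "{0..}" for n] by auto
  then show "sigma_sets UNIV ?E \<subseteq> sets (coord_field {0..})"
    using sets.sigma_sets_subset[of ?E "coord_field {0..}"] by simp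
qed

text \<open>Inserts \<open>z\<close> as a new initial state and moves the path one step later. The
  value at negative times is a filler, as only events about nonnegative times are pulled
  back.\<close>

definition path_prepend :: "'e \<Rightarrow> (int \<Rightarrow> 'e) \<Rightarrow> (int \<Rightarrow> 'e)" where
  "path_prepend z x = (\<lambda>k. if k \<le> 0 then z else x (k - 1))"

text \<open>Taking preimages under this map resets the clock: an event about times from
  \<open>n\<close> on becomes the same event for a path that starts at time 0. This is how the
  future enters the Markov property.\<close>

definition path_delay :: "nat \<Rightarrow> (int \<Rightarrow> 'e) \<Rightarrow> (int \<Rightarrow> 'e)" where
  "path_delay n x = (\<lambda>k. x (k - int n))"

lemma measurable_path_prepend [measurable]:
  "path_prepend z \<in> coord_field {0..} \<rightarrow>\<^sub>M coord_field {0..}"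
  "path_prepend z \<in> coord_field {0..int n} \<rightarrow>\<^sub>M coord_field {0..int (Suc n)}"
proof -
  have "(\<lambda>x. path_prepend z x k) \<in> coord_field I \<rightarrow>\<^sub>M borel" if "0 < k \<Longrightarrow> k - 1 \<in> I" for k I
    using that by (cases "0 < k") (auto simp: path_prepend_def intro: measurable_coord)
  then show "path_prepend z \<in> coord_field {0..} \<rightarrow>\<^sub>M coord_field {0..}"
    "path_prepend z \<in> coord_field {0..int n} \<rightarrow>\<^sub>M coord_field {0..int (Suc n)}"
    by (auto intro!: measurable_coord_fieldI)
qed

lemma measurable_path_delay:
  "path_delay n \<in> coord_field {int m..} \<rightarrow>\<^sub>M coord_field {int (n + m)..}"
  unfolding path_delay_def by (rule measurable_coord_field_comp) auto

text \<open>Events about strictly positive times cannot tell prepending a state from delaying by one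
  step, and the delay is measurable between the fields of the two half-lines.\<close>

lemma path_prepend_vimage_sets:
  assumes "A \<in> sets (coord_field {int (Suc n)..})"
  shows "path_prepend z -` A \<in> sets (coord_field {int n..})"
proof -
  have "path_delay 1 -` A \<inter> space (coord_field {int n..}) \<in> sets (coord_field {int n..})"
    using measurable_path_delay[of 1 n] assms by (intro measurable_sets) auto
  moreover have "path_delay 1 x \<in> A \<longleftrightarrow> path_prepend z x \<in> A" for x
    by (rule coord_field_agree[OF assms]) (auto simp: path_delay_def path_prepend_def)
  then have "path_delay 1 -` A = path_prepend z -` A" by blast
  ultimately show ?thesis by simp
qed

lemma measurable_path_shift [measurable]:
  "(path_shift :: (int \<Rightarrow> 'f::second_countable_topology) \<Rightarrow> _) \<in> borel \<rightarrow>\<^sub>M borel"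
proof -
  have "continuous_on UNIV (path_shift :: (int \<Rightarrow> 'f) \<Rightarrow> _)"
    unfolding path_shift_def by (intro continuous_on_coordinatewise_then_product) auto
  then show ?thesis by (rule borel_measurable_continuous_onI)
qed

lemma measurable_path_shift_funpow [measurable]:
  "(path_shift ^^ n :: (int \<Rightarrow> 'f::second_countable_topology) \<Rightarrow> _) \<in> borel \<rightarrow>\<^sub>M borel"
  by (induction n) auto

section \<open>One-step decomposition and the Markov property\<close>

locale quenched_chain =
  fixes PX :: "'e::polish_space \<Rightarrow> (int \<Rightarrow> 'f::polish_space) \<Rightarrow> 'e measure"
  assumes PX_kernel: "(\<lambda>(z, y). PX z y) \<in> borel \<Otimes>\<^sub>M borel \<rightarrow>\<^sub>M prob_algebra borel"
begin

abbreviation (input) law where "law \<equiv> quenched PX"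
abbreviation (input) marginal where "marginal n z y \<equiv> quenched_marginal PX z y n"

lemma measurable_PX [measurable (raw)]:
  assumes "f \<in> M \<rightarrow>\<^sub>M borel" "g \<in> M \<rightarrow>\<^sub>M borel"
  shows "(\<lambda>x. PX (f x) (g x)) \<in> M \<rightarrow>\<^sub>M prob_algebra borel"
  using measurable_compose[OF measurable_Pair[OF assms] PX_kernel] by simp

lemma prob_space_PX: "prob_space (PX z y)" and sets_PX [measurable_cong]: "sets (PX z y) = sets borel"
  using measurable_space[OF PX_kernel, of "(z, y)"] by (auto simp: space_prob_algebra space_pair_measure)

text \<open>The integrand carries the parameter \<open>p\<close> along because each unfolding of the
  recursion produces an inner integral that depends on the environment \<open>Y p\<close>.\<close>

lemma measurable_quenched_integral:
  assumes "F \<in> borel_measurable (N \<Otimes>\<^sub>M coord_field {0..int n})"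
    and Z[measurable]: "Z \<in> N \<rightarrow>\<^sub>M borel" and Y[measurable]: "Y \<in> N \<rightarrow>\<^sub>M borel"
  shows "(\<lambda>p. quenched_integral PX (Z p) (Y p) n (\<lambda>x. F (p, x))) \<in> borel_measurable N"
  using assms(1)
proof (induction n arbitrary: F)
  case 0
  note 0[measurable]
  have [measurable]: "(\<lambda>p k. Z p) \<in> N \<rightarrow>\<^sub>M coord_field {0..int 0}"
    by (intro measurable_coord_fieldI Z)
  show ?case by simp
next
  case (Suc n)
  note Suc.prems[measurable]
  let ?M = "N \<Otimes>\<^sub>M coord_field {0..int n}"
  have upd: "(\<lambda>q. (snd (fst q))(int (Suc n) := snd q)) \<in> ?M \<Otimes>\<^sub>M borel \<rightarrow>\<^sub>M coord_field {0..int (Suc n)}"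
  proof (rule measurable_coord_fieldI)
    fix k assume k: "k \<in> {0..int (Suc n)}"
    show "(\<lambda>q. ((snd (fst q))(int (Suc n) := snd q)) k) \<in> ?M \<Otimes>\<^sub>M borel \<rightarrow>\<^sub>M borel"
    proof (cases "k = int (Suc n)")
      case False
      then have "(\<lambda>x. x k) \<in> coord_field {0..int n} \<rightarrow>\<^sub>M borel" using k by (intro measurable_coord) auto
      from measurable_compose[OF measurable_compose[OF measurable_fst measurable_snd] this]
      show ?thesis using False by simp
    qed simp
  qed
  note upd[measurable]
  have 1: "(\<lambda>q. F (fst (fst q), (snd (fst q))(int (Suc n) := snd q))) \<in> borel_measurable (?M \<Otimes>\<^sub>M borel)"
    by measurable
  have [measurable]: "(\<lambda>x. x (int n)) \<in> coord_field {0..int n} \<rightarrow>\<^sub>M borel"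
    by (rule measurable_coord) simp
  have 2: "(\<lambda>q. PX (snd q (int n)) ((path_shift ^^ n) (Y (fst q)))) \<in> ?M \<rightarrow>\<^sub>M subprob_algebra borel"
    by (rule measurable_prob_algebraD) measurable
  have "(\<lambda>q. \<integral>\<^sup>+ w. F (fst q, (snd q)(int (Suc n) := w)) \<partial>PX (snd q (int n)) ((path_shift ^^ n) (Y (fst q))))
      \<in> borel_measurable ?M"
    using nn_integral_measurable_subprob_algebra2[OF _ 2, of "\<lambda>q w. F (fst q, (snd q)(int (Suc n) := w))"] 1
    by (simp add: split_beta')
  from Suc.IH[OF this] show ?case by simp
qed

text \<open>The recursive definition splits off the last transition, whereas the Markov property is
  proved by splitting off the first; this lemma converts one into the other.\<close>

lemma quenched_integral_prepend:
  assumes "f \<in> borel_measurable (coord_field {0..int (Suc n)})"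
  shows "quenched_integral PX z y (Suc n) f
    = (\<integral>\<^sup>+u. quenched_integral PX u (path_shift y) n (\<lambda>x. f (path_prepend z x)) \<partial>PX z y)"
  using assms
proof (induction n arbitrary: f)
  case 0
  \<comment> \<open>The two paths disagree after time 1, where one continues with \<open>z\<close>
    and the other with \<open>w\<close>, but \<open>f\<close> depends on times 0 and 1 only.\<close>
  have "f ((\<lambda>_. z)(int (Suc 0) := w)) = f (path_prepend z (\<lambda>_. w))" for w
    by (rule coord_field_fun_agree[OF 0]) (auto simp: path_prepend_def)
  then show ?case by simp
next
  case (Suc n)
  define g where "g x = (\<integral>\<^sup>+ w. f (x(int (Suc (Suc n)) := w))
    \<partial>PX (x (int (Suc n))) ((path_shift ^^ Suc n) y))" for x
  have "(\<lambda>q. (fst q)(int (Suc (Suc n)) := snd q))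
      \<in> coord_field {0..int (Suc n)} \<Otimes>\<^sub>M borel \<rightarrow>\<^sub>M coord_field {0..int (Suc (Suc n))}"
  proof (rule measurable_coord_fieldI)
    fix k assume k: "k \<in> {0..int (Suc (Suc n))}"
    show "(\<lambda>q. ((fst q)(int (Suc (Suc n)) := snd q)) k) \<in> coord_field {0..int (Suc n)} \<Otimes>\<^sub>M borel \<rightarrow>\<^sub>M borel"
    proof (cases "k = int (Suc (Suc n))")
      case False
      then have "(\<lambda>x. x k) \<in> coord_field {0..int (Suc n)} \<rightarrow>\<^sub>M borel"
        using k by (intro measurable_coord) auto
      from measurable_compose[OF measurable_fst this] show ?thesis using False by simp
    qed simp
  qed
  from measurable_compose[OF this Suc.prems]
  have 1: "(\<lambda>(x, w). f (x(int (Suc (Suc n)) := w))) \<in> borel_measurable (coord_field {0..int (Suc n)} \<Otimes>\<^sub>M borel)"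
    unfolding split_beta' .
  have [measurable]: "(\<lambda>x. x (int (Suc n))) \<in> coord_field {0..int (Suc n)} \<rightarrow>\<^sub>M borel"
    by (rule measurable_coord) simp
  have 2: "(\<lambda>x. PX (x (int (Suc n))) ((path_shift ^^ Suc n) y)) \<in> coord_field {0..int (Suc n)} \<rightarrow>\<^sub>M subprob_algebra borel"
    by (rule measurable_prob_algebraD) measurable
  have g: "g \<in> borel_measurable (coord_field {0..int (Suc n)})"
    unfolding g_def by (rule nn_integral_measurable_subprob_algebra2[OF 1 2])
  have upd: "(path_prepend z x)(int (Suc (Suc n)) := w) = path_prepend z (x(int (Suc n) := w))" for x w
    by (auto simp: path_prepend_def fun_eq_iff)
  have val: "path_prepend z x (int (Suc n)) = x (int n)" for x
    by (simp add: path_prepend_def)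
  have "quenched_integral PX z y (Suc (Suc n)) f = quenched_integral PX z y (Suc n) g"
    unfolding g_def by (subst quenched_integral.simps(2)) (rule refl)
  also have "\<dots> = (\<integral>\<^sup>+u. quenched_integral PX u (path_shift y) n (\<lambda>x. g (path_prepend z x)) \<partial>PX z y)"
    by (rule Suc.IH[OF g])
  also have "(\<lambda>x. g (path_prepend z x)) = (\<lambda>x. \<integral>\<^sup>+ w. f (path_prepend z (x(int (Suc n) := w)))
      \<partial>PX (x (int n)) ((path_shift ^^ n) (path_shift y)))"
    unfolding g_def upd val funpow_swap1 by (simp add: fun_eq_iff funpow_swap1)
  finally show ?case by simp
qed

lemma prob_space_law: "prob_space (law z y)"
  and sets_law [measurable_cong]: "sets (law z y) = sets (coord_field {0..})"
  and emeasure_law: "A \<in> sets (coord_field {0..int n}) \<Longrightarrow>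
    emeasure (law z y) A = quenched_integral PX z y n (indicator A)"
  using is_quenched_law_quenched[OF PX_kernel, of z y] by (auto simp: is_quenched_law_def)

lemma space_law [simp]: "space (law z y) = UNIV"
  using sets_eq_imp_space_eq[OF sets_law[of z y]] by simp

lemma measurable_law:
  "(\<lambda>p. law (fst p) (snd p)) \<in> borel \<Otimes>\<^sub>M borel \<rightarrow>\<^sub>M prob_algebra (coord_field {0..})"
proof (rule measurable_prob_algebra_generated[OF sets_coord_field_generated])
  interpret algebra UNIV "\<Union>n::nat. sets (coord_field {0..int n} :: (int \<Rightarrow> 'e) measure)"
    by (rule algebra_coord_field_union)
  show "Int_stable (\<Union>n::nat. sets (coord_field {0..int n} :: (int \<Rightarrow> 'e) measure))"
    by (auto intro!: Int_stableI simp del: UN_iff)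
  fix A :: "(int \<Rightarrow> 'e) set" assume "A \<in> (\<Union>n::nat. sets (coord_field {0..int n}))"
  then obtain n :: nat where A[measurable]: "A \<in> sets (coord_field {0..int n})" by blast
  have "(\<lambda>q. indicator A (snd q) :: ennreal) \<in> borel_measurable ((borel \<Otimes>\<^sub>M borel) \<Otimes>\<^sub>M coord_field {0..int n})"
    by measurable
  from measurable_quenched_integral[OF this measurable_fst measurable_snd]
  show "(\<lambda>p. emeasure (law (fst p) (snd p)) A) \<in> borel_measurable (borel \<Otimes>\<^sub>M borel)"
    by (simp add: emeasure_law[OF A])
qed (auto simp: prob_space_law sets_law)

lemma measurable_law_comp [measurable (raw)]:
  assumes "f \<in> M \<rightarrow>\<^sub>M borel" "g \<in> M \<rightarrow>\<^sub>M borel"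
  shows "(\<lambda>x. law (f x) (g x)) \<in> M \<rightarrow>\<^sub>M prob_algebra (coord_field {0..})"
  using measurable_compose[OF measurable_Pair[OF assms] measurable_law] by simp

text \<open>The law is determined by its values on finite-horizon events, so it is enough that the
  mixture on the right has the required iterated integrals.\<close>

lemma law_step:
  "law z y = PX z y \<bind> (\<lambda>u. distr (law u (path_shift y)) (coord_field {0..}) (path_prepend z))"
    (is "_ = Giry_Monad.bind _ ?K")
proof (rule is_quenched_law_unique[OF is_quenched_law_quenched[OF PX_kernel]])
  have K: "?K \<in> borel \<rightarrow>\<^sub>M prob_algebra (coord_field {0..})"
    by (rule measurable_compose[OF _ measurable_distr_prob_space]) measurable
  have PXs: "PX z y \<in> space (prob_algebra borel)"
    by (simp add: space_prob_algebra prob_space_PX sets_PX)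
  have em: "emeasure (PX z y \<bind> ?K) A = quenched_integral PX z y n (indicator A)"
    if A: "A \<in> sets (coord_field {0..int n})" for n A
  proof -
    have A0[measurable]: "A \<in> sets (coord_field {0..})"
      using A sets_coord_field_mono[of "{0..int n}" "{0..}"] by auto
    have "emeasure (PX z y \<bind> ?K) A = (\<integral>\<^sup>+u. emeasure (?K u) A \<partial>PX z y)"
      by (rule emeasure_bind_prob_algebra[OF PXs K A0])
    also have "\<dots> = (\<integral>\<^sup>+u. emeasure (law u (path_shift y)) (path_prepend z -` A) \<partial>PX z y)"
      by (intro nn_integral_cong) (simp add: emeasure_distr)
    also have "\<dots> = quenched_integral PX z y n (indicator A)"
    proof (cases n)
      \<comment> \<open>No transition can be split off here. An event about time 0 pulls back under
        \<open>path_prepend z\<close> to the whole space or to the empty set.\<close>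
      case 0
      have "path_prepend z -` A = (if (\<lambda>_. z) \<in> A then UNIV else {})"
        using coord_field_agree[OF A, of "path_prepend z _" "\<lambda>_. z"] 0
        by (auto simp: path_prepend_def)
      then show ?thesis
        using 0 prob_space.emeasure_space_1[OF prob_space_law] prob_space.emeasure_space_1[OF prob_space_PX]
        by (auto simp: indicator_def)
    next
      case (Suc m)
      have B: "path_prepend z -` A \<in> sets (coord_field {0..int m})"
        using measurable_sets[OF measurable_path_prepend(2) A[unfolded Suc]] by simp
      have ind: "indicator (path_prepend z -` A) = (\<lambda>x. indicator A (path_prepend z x) :: ennreal)"
        by (auto simp: indicator_def)
      show ?thesis
        unfolding Suc
        by (subst quenched_integral_prepend)
          (use A Suc in \<open>simp_all add: emeasure_law[OF B] ind\<close>)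
    qed
    finally show ?thesis .
  qed
  show "is_quenched_law PX z y (PX z y \<bind> ?K)"
    unfolding is_quenched_law_def
    using prob_space_bind'[OF PXs K] sets_bind'[OF PXs K] em by blast
qed

lemma nn_integral_law_step:
  assumes f[measurable]: "f \<in> borel_measurable (coord_field {0..})"
  shows "(\<integral>\<^sup>+x. f x \<partial>law z y) = (\<integral>\<^sup>+u. \<integral>\<^sup>+x. f (path_prepend z x) \<partial>law u (path_shift y) \<partial>PX z y)"
proof -
  have "(\<lambda>u. distr (law u (path_shift y)) (coord_field {0..}) (path_prepend z))
      \<in> borel \<rightarrow>\<^sub>M prob_algebra (coord_field {0..})"
    by (rule measurable_compose[OF _ measurable_distr_prob_space]) measurable
  then have K: "(\<lambda>u. distr (law u (path_shift y)) (coord_field {0..}) (path_prepend z))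
      \<in> PX z y \<rightarrow>\<^sub>M subprob_algebra (coord_field {0..})"
    by (simp add: measurable_prob_algebraD cong: measurable_cong_sets)
  show ?thesis
    by (subst law_step, subst nn_integral_bind[OF f K])
      (auto intro!: nn_integral_cong simp: nn_integral_distr)
qed

lemma AE_law_0: "AE x in law z y. x 0 = z"
proof (rule AE_I)
  have "(\<lambda>x. x 0) -` (- {z}) \<inter> space (coord_field {0..int 0}) \<in> sets (coord_field {0..int 0} :: (int \<Rightarrow> 'e) measure)"
    by (rule measurable_sets[OF measurable_coord]) auto
  then have A: "{x. x 0 \<noteq> z} \<in> sets (coord_field {0..int 0} :: (int \<Rightarrow> 'e) measure)"
    by (simp add: vimage_def)
  show "emeasure (law z y) {x. x 0 \<noteq> z} = 0"
    by (simp add: emeasure_law[OF A])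
  show "{x. x 0 \<noteq> z} \<in> sets (law z y)"
    using A sets_coord_field_mono[of "{0..int 0}" "{0..}"] by (auto simp: sets_law)
qed auto

lemma sets_coord_field_atLeast: "A \<in> sets (coord_field {int n..}) \<Longrightarrow> A \<in> sets (coord_field {0..})"
  using sets_coord_field_mono[of "{int n..}" "{0..}"] by auto

lemma path_delay_vimage_sets:
  "A \<in> sets (coord_field {int n..}) \<Longrightarrow> path_delay n -` A \<in> sets (coord_field {0..})"
  using measurable_sets[OF measurable_path_delay[of n 0]] by simp

text \<open>Induction on \<open>n\<close> by splitting off the first transition. The starting state,
  the environment and both events vary, since the remaining chain starts at the next state in the
  shifted environment and sees the events pulled back under \<open>path_prepend z\<close>.\<close>

lemma Markov_property:
  assumes "A \<in> sets (coord_field {int n..})" "B \<in> sets (coord_field {0..int n})"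
  shows "emeasure (law z y) (A \<inter> B)
    = (\<integral>\<^sup>+x. indicator B x * emeasure (law (x (int n)) ((path_shift ^^ n) y)) (path_delay n -` A) \<partial>law z y)"
  using assms
proof (induction n arbitrary: z y A B)
  case 0
  have [measurable]: "A \<in> sets (coord_field {0..})" "B \<in> sets (coord_field {0..})"
    using 0 sets_coord_field_mono[of "{0..int 0}" "{0..}"] by auto
  \<comment> \<open>As the chain starts at \<open>z\<close>, the indicator of an event about time 0
    is almost surely this constant.\<close>
  define c :: ennreal where "c = indicator B (\<lambda>_. z)"
  have B: "indicator B x = c" if "x 0 = z" for x
    using coord_field_agree[OF 0(2), of x "\<lambda>_. z"] that by (simp add: c_def indicator_def)
  have "(\<integral>\<^sup>+x. indicator B x * emeasure (law (x (int 0)) ((path_shift ^^ 0) y)) (path_delay 0 -` A) \<partial>law z y)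
      = (\<integral>\<^sup>+x. c * emeasure (law z y) A \<partial>law z y)"
    using AE_law_0[of z y]
    by (intro nn_integral_cong_AE) (auto elim!: eventually_mono simp: B path_delay_def vimage_def)
  also have "\<dots> = c * emeasure (law z y) A"
    using prob_space.emeasure_space_1[OF prob_space_law] by simp
  also have "\<dots> = (\<integral>\<^sup>+x. c * indicator A x \<partial>law z y)"
    by (subst nn_integral_cmult) (auto simp: sets_law)
  also have "\<dots> = (\<integral>\<^sup>+x. indicator (A \<inter> B) x \<partial>law z y)"
    using AE_law_0[of z y]
    by (intro nn_integral_cong_AE) (auto elim!: eventually_mono simp: B indicator_inter_arith mult.commute)
  finally show ?case by (simp add: sets_law)
next
  case (Suc n)
  note A = Suc.prems(1) and B = Suc.prems(2)
  have [measurable]: "A \<in> sets (coord_field {0..})" "B \<in> sets (coord_field {0..})"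
    using sets_coord_field_atLeast[OF A] B sets_coord_field_mono[of "{0..int (Suc n)}" "{0..}"] by auto
  have D[measurable]: "path_delay (Suc n) -` A \<in> sets (coord_field {0..})"
    by (rule path_delay_vimage_sets[OF A])
  have [measurable]: "(\<lambda>x. x (int (Suc n))) \<in> coord_field {0..} \<rightarrow>\<^sub>M borel"
    by (rule measurable_coord) simp
  have em: "(\<lambda>x. emeasure (law (x (int (Suc n))) ((path_shift ^^ Suc n) y)) (path_delay (Suc n) -` A))
      \<in> borel_measurable (coord_field {0..})"
    by (rule measurable_compose[OF measurable_prob_algebraD measurable_emeasure_subprob_algebra[OF D]])
      measurable
  have A': "path_prepend z -` A \<in> sets (coord_field {int n..})"
    by (rule path_prepend_vimage_sets[OF A])
  have B': "path_prepend z -` B \<in> sets (coord_field {0..int n})"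
    using measurable_sets[OF measurable_path_prepend(2) B] by simp
  have AB: "path_prepend z -` A \<inter> path_prepend z -` B \<in> sets (coord_field {0..})"
    using measurable_sets[OF measurable_path_prepend(1)[of z], of "A \<inter> B"] by simp
  \<comment> \<open>The two paths agree at all positive times, and \<open>A\<close> only sees times
    from \<open>Suc n\<close> on.\<close>
  have "path_prepend z (path_delay n x) \<in> A \<longleftrightarrow> path_delay (Suc n) x \<in> A" for x
    by (rule coord_field_agree[OF A]) (auto simp: path_delay_def path_prepend_def algebra_simps)
  then have delay: "path_delay n -` (path_prepend z -` A) = path_delay (Suc n) -` A"
    by blast
  have "emeasure (law z y) (A \<inter> B) = (\<integral>\<^sup>+x. indicator (A \<inter> B) x \<partial>law z y)"
    by (simp add: sets_law)
  also have "\<dots> = (\<integral>\<^sup>+u. \<integral>\<^sup>+x. indicator (A \<inter> B) (path_prepend z x) \<partial>law u (path_shift y) \<partial>PX z y)"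
    by (rule nn_integral_law_step) measurable
  also have "\<dots> = (\<integral>\<^sup>+u. emeasure (law u (path_shift y)) (path_prepend z -` A \<inter> path_prepend z -` B) \<partial>PX z y)"
    using AB by (intro nn_integral_cong) (simp add: sets_law flip: nn_integral_indicator vimage_Int indicator_vimage)
  also have "\<dots> = (\<integral>\<^sup>+u. \<integral>\<^sup>+x. indicator B (path_prepend z x)
      * emeasure (law (x (int n)) ((path_shift ^^ n) (path_shift y))) (path_delay (Suc n) -` A)
      \<partial>law u (path_shift y) \<partial>PX z y)"
    by (subst Suc.IH[OF A' B']) (simp add: delay indicator_vimage)
  also have "\<dots> = (\<integral>\<^sup>+x. indicator B x
      * emeasure (law (x (int (Suc n))) ((path_shift ^^ Suc n) y)) (path_delay (Suc n) -` A) \<partial>law z y)"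
  proof -
    let ?h = "\<lambda>x. indicator B x
      * emeasure (law (x (int (Suc n))) ((path_shift ^^ Suc n) y)) (path_delay (Suc n) -` A)"
    have "?h \<in> borel_measurable (coord_field {0..})" using em by measurable
    then have "(\<integral>\<^sup>+x. ?h x \<partial>law z y) = (\<integral>\<^sup>+u. \<integral>\<^sup>+x. ?h (path_prepend z x) \<partial>law u (path_shift y) \<partial>PX z y)"
      by (rule nn_integral_law_step)
    moreover have "path_prepend z x (int (Suc n)) = x (int n)" for x
      by (simp add: path_prepend_def)
    ultimately show ?thesis by (simp only: funpow_Suc_right o_def)
  qed
  finally show ?case .
qed

lemma measurable_coord_law [measurable]: "(\<lambda>x. x (int n)) \<in> law z y \<rightarrow>\<^sub>M borel"
  by (simp add: measurable_coord cong: measurable_cong_sets add: sets_law)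

lemma prob_space_marginal: "prob_space (marginal n z y)"
  and sets_marginal [measurable_cong]: "sets (marginal n z y) = sets borel"
  unfolding quenched_marginal_def
  using prob_space.prob_space_distr[OF prob_space_law measurable_coord_law] by auto

lemma space_marginal [simp]: "space (marginal n z y) = UNIV"
  by (simp add: quenched_marginal_def)

lemma measurable_marginal [measurable (raw)]:
  assumes [measurable]: "f \<in> M \<rightarrow>\<^sub>M borel" "g \<in> M \<rightarrow>\<^sub>M borel"
  shows "(\<lambda>x. marginal n (f x) (g x)) \<in> M \<rightarrow>\<^sub>M prob_algebra borel"
  unfolding quenched_marginal_def
  by (rule measurable_compose[OF measurable_law_comp[OF assms] measurable_distr_prob_space])
     (rule measurable_coord, simp)

lemma measurable_measure_law:
  assumes "A \<in> sets (coord_field {0..})"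
  shows "(\<lambda>u. measure (law u y) A) \<in> borel_measurable borel"
  by (rule measurable_compose[OF _ measurable_measure_prob_algebra[OF assms]]) measurable

lemma measure_law_Markov:
  assumes A: "A \<in> sets (coord_field {int n..})" and B: "B \<in> sets (coord_field {0..int n})"
  shows "measure (law z y) (A \<inter> B)
    = (\<integral>x. indicator B x * measure (law (x (int n)) ((path_shift ^^ n) y)) (path_delay n -` A) \<partial>law z y)"
proof -
  interpret P: prob_space "law z y" by (rule prob_space_law)
  note D = path_delay_vimage_sets[OF A]
  have [measurable]: "B \<in> sets (coord_field {0..})"
    using B sets_coord_field_mono[of "{0..int n}" "{0..}"] by auto
  have m: "(\<lambda>x. measure (law (x (int n)) ((path_shift ^^ n) y)) (path_delay n -` A)) \<in> borel_measurable (law z y)"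
    by (rule measurable_compose[OF measurable_coord_law measurable_measure_law[OF D]])
  have "ennreal (measure (law z y) (A \<inter> B)) = (\<integral>\<^sup>+x. ennreal (indicator B x
      * measure (law (x (int n)) ((path_shift ^^ n) y)) (path_delay n -` A)) \<partial>law z y)"
    unfolding P.emeasure_eq_measure[symmetric] Markov_property[OF assms]
    by (intro nn_integral_cong)
      (simp add: ennreal_mult ennreal_indicator finite_measure.emeasure_eq_measure[OF prob_space.finite_measure[OF prob_space_law]])
  also have "\<dots> = ennreal (\<integral>x. indicator B x
      * measure (law (x (int n)) ((path_shift ^^ n) y)) (path_delay n -` A) \<partial>law z y)"
    using m by (intro nn_integral_eq_integral P.integrable_const_bound[where B=1] AE_I2)
      (auto simp: indicator_def prob_space.prob_le_1[OF prob_space_law] sets_law)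
  finally show ?thesis by (subst (asm) ennreal_inj) (auto intro!: integral_nonneg_AE)
qed

lemma measure_law_marginal:
  assumes A: "A \<in> sets (coord_field {int n..})"
  shows "measure (law z y) A
    = (\<integral>u. measure (law u ((path_shift ^^ n) y)) (path_delay n -` A) \<partial>marginal n z y)"
proof -
  have "measure (law z y) (A \<inter> UNIV)
    = (\<integral>x. indicator UNIV x * measure (law (x (int n)) ((path_shift ^^ n) y)) (path_delay n -` A) \<partial>law z y)"
    by (rule measure_law_Markov[OF A]) (use sets.top[of "coord_field {0..int n}"] in simp)
  then show ?thesis
    unfolding quenched_marginal_def
    by (subst integral_distr[OF measurable_coord_law measurable_measure_law[OF path_delay_vimage_sets[OF A]]]) simp
qed

lemma measure_marginal:
  "U \<in> sets borel \<Longrightarrow> measure (marginal n z y) U = measure (law z y) ((\<lambda>x. x (int n)) -` U)"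
  unfolding quenched_marginal_def by (simp add: measure_distr)

lemma coord_vimage_sets:
  "U \<in> sets borel \<Longrightarrow> n \<le> m \<Longrightarrow> (\<lambda>x. x (int m)) -` U \<in> sets (coord_field {int n..})"
  unfolding sets_coord_field by (intro sigma_sets.Basic CollectI exI[of _ "int m"] exI[of _ U]) auto

text \<open>The Chapman-Kolmogorov equation: after \<open>n\<close> steps the chain continues in the
  environment shifted by \<open>n\<close>.\<close>

lemma measure_marginal_add:
  assumes "U \<in> sets borel"
  shows "measure (marginal (n + m) z y) U
    = (\<integral>u. measure (marginal m u ((path_shift ^^ n) y)) U \<partial>marginal n z y)"
proof -
  have "path_delay n -` (\<lambda>x. x (int (n + m))) -` U = (\<lambda>x. x (int m)) -` U"
    by (auto simp: path_delay_def)
  then show ?thesis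
    using measure_law_marginal[OF coord_vimage_sets[OF assms, of n "n + m"], of z y]
    by (simp add: measure_marginal assms)
qed

end

section \<open>Tail events and merging\<close>

text \<open>Expanding the square, the conditional mean of (\<beta>(v) - \<beta>(w))^2 is at most the
  conditional mean of \<beta>(v)^2 minus \<beta>(w)^2, by the submartingale inequality multiplied by
  \<beta>(w) >= 0. Invariance of \<open>m\<close> makes the integral of this bound vanish.\<close>

lemma stationary_submartingale_AE_const:
  fixes \<beta> :: "'a \<Rightarrow> real"
  assumes m: "m \<in> space (prob_algebra N)" and \<kappa>: "\<kappa> \<in> N \<rightarrow>\<^sub>M prob_algebra N"
    and inv: "m \<bind> \<kappa> = m"
    and \<beta>[measurable]: "\<beta> \<in> borel_measurable N" and b: "\<And>w. 0 \<le> \<beta> w" "\<And>w. \<beta> w \<le> 1"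
    and sub: "\<And>w. w \<in> space N \<Longrightarrow> \<beta> w \<le> (\<integral>v. \<beta> v \<partial>\<kappa> w)"
  shows "AE w in m. AE v in \<kappa> w. \<beta> v = \<beta> w"
proof -
  interpret m: prob_space m using m by (simp add: space_prob_algebra)
  have sm[measurable_cong]: "sets m = sets N" using m by (simp add: space_prob_algebra)
  note spm = sets_eq_imp_space_eq[OF sm]
  have \<kappa>m: "\<kappa> \<in> m \<rightarrow>\<^sub>M subprob_algebra N"
    using measurable_prob_algebraD[OF \<kappa>] by (simp cong: measurable_cong_sets add: sm)
  have P: "prob_space (\<kappa> w)" "sets (\<kappa> w) = sets N" if "w \<in> space N" for w
    using measurable_space[OF \<kappa> that] by (auto simp: space_prob_algebra)
  have bsq: "(\<beta> v)\<^sup>2 \<le> 1" for v using b[of v] by (simp add: abs_square_le_1)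
  \<comment> \<open>The upper bound for the conditional mean squared increment; it is nonnegative
    and has integral zero, hence vanishes almost surely.\<close>
  define h where "h w = (\<integral>v. (\<beta> v)\<^sup>2 \<partial>\<kappa> w) - (\<beta> w)\<^sup>2" for w
  have sq: "(\<lambda>w. \<integral>v. (\<beta> v)\<^sup>2 \<partial>\<kappa> w) \<in> borel_measurable m"
    by (rule measurable_compose[OF \<kappa>m integral_measurable_subprob_algebra]) simp
  have D: "0 \<le> (\<integral>v. (\<beta> v - \<beta> w)\<^sup>2 \<partial>\<kappa> w) \<and> (\<integral>v. (\<beta> v - \<beta> w)\<^sup>2 \<partial>\<kappa> w) \<le> h w
      \<and> integrable (\<kappa> w) (\<lambda>v. (\<beta> v - \<beta> w)\<^sup>2) \<and> \<bar>\<integral>v. (\<beta> v)\<^sup>2 \<partial>\<kappa> w\<bar> \<le> 1"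
    if w: "w \<in> space N" for w
  proof -
    interpret \<kappa>: prob_space "\<kappa> w" by (rule P[OF w])
    note P(2)[OF w, measurable_cong]
    have int: "integrable (\<kappa> w) \<beta>" "integrable (\<kappa> w) (\<lambda>v. (\<beta> v)\<^sup>2)"
      using b bsq by (auto intro!: \<kappa>.integrable_const_bound[where B=1])
    have exp: "(\<beta> v - \<beta> w)\<^sup>2 = (\<beta> v)\<^sup>2 - 2 * \<beta> w * \<beta> v + (\<beta> w)\<^sup>2" for v
      by (simp add: power2_eq_square algebra_simps)
    have "(\<integral>v. (\<beta> v - \<beta> w)\<^sup>2 \<partial>\<kappa> w) = (\<integral>v. (\<beta> v)\<^sup>2 \<partial>\<kappa> w) - 2 * \<beta> w * (\<integral>v. \<beta> v \<partial>\<kappa> w) + (\<beta> w)\<^sup>2"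
      unfolding exp using int by (simp add: \<kappa>.prob_space)
    moreover have "\<beta> w * \<beta> w \<le> \<beta> w * (\<integral>v. \<beta> v \<partial>\<kappa> w)"
      by (rule mult_left_mono[OF sub[OF w] b(1)])
    ultimately have "(\<integral>v. (\<beta> v - \<beta> w)\<^sup>2 \<partial>\<kappa> w) \<le> h w"
      by (simp add: h_def power2_eq_square algebra_simps)
    moreover have "integrable (\<kappa> w) (\<lambda>v. (\<beta> v - \<beta> w)\<^sup>2)"
      unfolding exp using int by simp
    moreover have "(\<integral>v. (\<beta> v)\<^sup>2 \<partial>\<kappa> w) \<le> (\<integral>v. 1 \<partial>\<kappa> w)"
      using int bsq by (intro integral_mono) auto
    ultimately show ?thesis by (simp add: \<kappa>.prob_space)
  qed
  have int_sq: "integrable m (\<lambda>w. \<integral>v. (\<beta> v)\<^sup>2 \<partial>\<kappa> w)" "integrable m (\<lambda>w. (\<beta> w)\<^sup>2)"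
    using sq D bsq by (auto intro!: m.integrable_const_bound[where B=1] simp: spm)
  have "(\<integral>w. (\<beta> w)\<^sup>2 \<partial>(m \<bind> \<kappa>)) = (\<integral>w. \<integral>v. (\<beta> v)\<^sup>2 \<partial>\<kappa> w \<partial>m)"
    by (rule integral_bind[where K=N and B=1 and B'=1])
      (use \<kappa>m bsq prob_space.emeasure_space_1[OF P(1)] spm in \<open>auto intro: m.finite_measure_axioms\<close>)
  then have "(\<integral>w. h w \<partial>m) = 0"
    unfolding h_def inv using int_sq by simp
  moreover have "integrable m h" unfolding h_def using int_sq by simp
  moreover have "AE w in m. 0 \<le> h w" using D spm by (intro AE_I2) (metis order_trans)
  ultimately have "AE w in m. h w = 0" using integral_nonneg_eq_0_iff_AE by blast
  moreover have "AE w in m. h w = 0 \<longrightarrow> (AE v in \<kappa> w. \<beta> v = \<beta> w)"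
  proof (rule AE_I2, rule impI)
    fix w assume w: "w \<in> space m" "h w = 0"
    then have "(\<integral>v. (\<beta> v - \<beta> w)\<^sup>2 \<partial>\<kappa> w) = 0" "integrable (\<kappa> w) (\<lambda>v. (\<beta> v - \<beta> w)\<^sup>2)"
      using D[of w] unfolding spm by linarith+
    then have "AE v in \<kappa> w. (\<beta> v - \<beta> w)\<^sup>2 = 0"
      by (subst (asm) integral_nonneg_eq_0_iff_AE) auto
    then show "AE v in \<kappa> w. \<beta> v = \<beta> w" by simp
  qed
  ultimately show ?thesis by (rule AE_mp)
qed

section \<open>Tail events\<close>

lemma sets_tail_field: "A \<in> tail_field \<Longrightarrow> A \<in> sets (coord_field {int n..})"
  by (auto simp: tail_field_def)

lemma Compl_tail_field:
  assumes "A \<in> tail_field" shows "- A \<in> tail_field"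
  unfolding tail_field_def
  using sets.compl_sets[OF sets_tail_field[OF assms]] by (auto simp: Compl_eq_Diff_UNIV)

lemma path_delay_tail_field:
  assumes "A \<in> tail_field" shows "path_delay n -` A \<in> tail_field"
proof -
  have "path_delay n -` A \<inter> space (coord_field {int m..}) \<in> sets (coord_field {int m..})" for m
    by (rule measurable_sets[OF measurable_path_delay sets_tail_field[OF assms]])
  then show ?thesis by (auto simp: tail_field_def)
qed

text \<open>If \<open>B n\<close> maximises \<open>\<nu> = P - P'\<close> over \<open>\<F>\<^bsub>[n,\<infinity>[\<^esub>\<close>, then \<open>\<nu>(B k \<union> U) \<ge> \<nu>(U)\<close> for
  \<open>U \<in> \<F>\<^bsub>[k,\<infinity>[\<^esub>\<close>, because \<open>\<nu>(B k \<inter> U) \<le> \<nu>(B k)\<close>; hence passing to \<open>limsup B\<close> loses nothing.\<close>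
lemma tail_maximiser:
  fixes P P' :: "(int \<Rightarrow> 'e::topological_space) measure"
  assumes P: "prob_space P" "prob_space P'"
    and sets: "sets P = sets (coord_field {0..})" "sets P' = sets (coord_field {0..})"
    and B: "\<And>n. B n \<in> sets (coord_field {int n..})"
    and max: "\<And>n A. A \<in> sets (coord_field {int n..}) \<Longrightarrow>
      measure P A - measure P' A \<le> measure P (B n) - measure P' (B n)"
    and l: "\<And>n. l \<le> measure P (B n) - measure P' (B n)"
  shows "\<exists>A\<in>tail_field. l \<le> measure P A - measure P' A"
proof -
  interpret P: prob_space P by fact
  interpret P': prob_space P' by fact
  define \<nu> where "\<nu> A = measure P A - measure P' A" for A
  have mono: "A \<in> sets (coord_field {int n..})" if "A \<in> sets (coord_field {int k..})" "n \<le> k"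
    for A :: "(int \<Rightarrow> 'e) set" and n k
    using sets_coord_field_mono[of "{int k..}" "{int n..}"] that by auto
  have mono0: "A \<in> sets P \<and> A \<in> sets P'" if "A \<in> sets (coord_field {int k..})" for A k
    using mono[OF that, of 0] by (simp add: sets)
  define V where "V k j = (\<Union>i\<le>j. B (k + i))" for k j :: nat
  have V: "V k j \<in> sets (coord_field {int k..})" for k j
    unfolding V_def by (intro sets.finite_UN mono[OF B]) auto
  have V_Suc: "V k (Suc j) = B k \<union> V (Suc k) j" for k j
    by (auto simp: V_def atMost_Suc_eq_insert_0)
  have lV: "l \<le> \<nu> (V k j)" for k j
  \<comment> \<open>The starting index varies because a longer union from \<open>k\<close> is
    \<open>B k\<close> joined to a shorter union from \<open>Suc k\<close>.\<close>
  proof (induction j arbitrary: k)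
    case 0
    then show ?case using l[of k] by (simp add: V_def \<nu>_def)
  next
    case (Suc j)
    have W: "V (Suc k) j \<in> sets (coord_field {int k..})" by (rule mono[OF V]) simp
    have "\<nu> (V k (Suc j)) = \<nu> (B k) + \<nu> (V (Suc k) j) - \<nu> (B k \<inter> V (Suc k) j)"
      unfolding \<nu>_def V_Suc using mono0[OF B[of k]] mono0[OF W]
      by (subst (1 2) measure_Un3) (auto simp: P.fmeasurable_eq_sets P'.fmeasurable_eq_sets)
    moreover have "\<nu> (B k \<inter> V (Suc k) j) \<le> \<nu> (B k)"
      unfolding \<nu>_def by (intro max sets.Int B W)
    ultimately show ?case using Suc[of "Suc k"] by simp
  qed
  have incV: "incseq (V k)" for k
    unfolding V_def by (intro monoI UN_mono) auto
  define U where "U k = (\<Union>j. V k j)" for k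
  have U: "U k \<in> sets (coord_field {int k..})" for k
    unfolding U_def using V by (intro sets.countable_UN) auto
  have "(\<lambda>j. \<nu> (V k j)) \<longlonglongrightarrow> \<nu> (U k)" for k
    unfolding \<nu>_def U_def using mono0[OF V] incV
    by (intro tendsto_diff P.finite_Lim_measure_incseq P'.finite_Lim_measure_incseq) auto
  then have lU: "l \<le> \<nu> (U k)" for k
    by (rule LIMSEQ_le_const) (use lV in auto)
  have dec: "decseq U"
    unfolding U_def by (rule decseq_SucI) (use V_Suc in blast)
  define A where "A = (\<Inter>k. U k)"
  have "(\<lambda>k. \<nu> (U k)) \<longlonglongrightarrow> \<nu> A"
    unfolding \<nu>_def A_def using mono0[OF U] dec
    by (intro tendsto_diff P.finite_Lim_measure_decseq P'.finite_Lim_measure_decseq) auto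
  then have "l \<le> \<nu> A"
    by (rule LIMSEQ_le_const) (use lU in auto)
  moreover have "A \<in> tail_field"
  proof -
    \<comment> \<open>As \<open>U\<close> decreases, the intersection may start at any
      \<open>n\<close>; this places it in the field of [n, \<infinity>) for every
      \<open>n\<close>.\<close>
    have "U (n + k) \<subseteq> U k" for n k by (rule decseqD[OF dec]) simp
    then have "A = (\<Inter>k. U (n + k))" for n unfolding A_def by blast
    moreover have "(\<Inter>k. U (n + k)) \<in> sets (coord_field {int n..})" for n
      by (intro sets.countable_INT) (auto intro: mono[OF U])
    ultimately show ?thesis by (simp add: tail_field_def)
  qed
  ultimately show ?thesis by (auto simp: \<nu>_def)
qed

section \<open>The gap between marginals and its limit\<close>

context quenched_chain
begin

definition merge_gap :: "nat \<Rightarrow> 'e \<Rightarrow> 'e \<Rightarrow> (int \<Rightarrow> 'f) \<Rightarrow> real" where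
  "merge_gap n z z' y = set_gap (marginal n z y) (marginal n z' y)"

definition merge_limit :: "'e \<Rightarrow> 'e \<Rightarrow> (int \<Rightarrow> 'f) \<Rightarrow> real" where
  "merge_limit z z' y = lim (\<lambda>n. merge_gap n z z' y)"

text \<open>Given the state at time \<open>n\<close>, the conditional probability of
  \<open>A\<close> is a [0,1]-valued function of that state which does not depend on the initial
  state. The two probabilities are thus integrals of one test function against the two
  marginals.\<close>

lemma measure_law_diff_le_merge_gap:
  assumes A: "A \<in> sets (coord_field {int n..})"
  shows "measure (law z y) A - measure (law z' y) A \<le> merge_gap n z z' y"
  unfolding measure_law_marginal[OF A] merge_gap_def
  using measurable_measure_law[OF path_delay_vimage_sets[OF A]]
  by (intro integral_diff_le_set_gap prob_space_marginal)
    (auto simp: sets_marginal prob_space.prob_le_1[OF prob_space_law] cong: measurable_cong_sets)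

text \<open>An event about time \<open>Suc n\<close> is in particular an event about times from
  \<open>n\<close> on.\<close>

lemma decseq_merge_gap: "decseq (\<lambda>n. merge_gap n z z' y)"
proof (rule decseq_SucI)
  fix n
  have "measure (marginal (Suc n) z y) U - measure (marginal (Suc n) z' y) U \<le> merge_gap n z z' y"
    if "U \<in> sets borel" for U
    unfolding measure_marginal[OF that]
    by (rule measure_law_diff_le_merge_gap) (rule coord_vimage_sets[OF that], simp)
  then show "merge_gap (Suc n) z z' y \<le> merge_gap n z z' y"
    unfolding merge_gap_def[of "Suc n"] set_gap_def by (intro cSUP_least) (auto simp: sets_marginal)
qed

lemma merge_gap_nonneg: "0 \<le> merge_gap n z z' y" and merge_gap_le_1: "merge_gap n z z' y \<le> 1"
  unfolding merge_gap_def by (intro set_gap_nonneg set_gap_le_1 prob_space_marginal)+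

lemma merge_gap_tendsto: "(\<lambda>n. merge_gap n z z' y) \<longlonglongrightarrow> merge_limit z z' y"
  unfolding merge_limit_def convergent_LIMSEQ_iff[symmetric]
  by (intro Bseq_monoseq_convergent decseq_bounded[of _ 0] decseq_imp_monoseq decseq_merge_gap)
    (auto intro: merge_gap_nonneg)

lemma merge_limit_le: "merge_limit z z' y \<le> merge_gap n z z' y"
  by (rule decseq_ge[OF decseq_merge_gap merge_gap_tendsto])

lemma merge_limit_nonneg: "0 \<le> merge_limit z z' y"
  by (rule LIMSEQ_le_const[OF merge_gap_tendsto]) (use merge_gap_nonneg in auto)

lemma merge_limit_le_1: "merge_limit z z' y \<le> 1"
  using merge_limit_le[of z z' y 0] merge_gap_le_1[of 0 z z' y] by simp

lemma measurable_merge_gap [measurable (raw)]: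
  assumes [measurable]: "f \<in> M \<rightarrow>\<^sub>M borel" "g \<in> M \<rightarrow>\<^sub>M borel" "h \<in> M \<rightarrow>\<^sub>M borel"
  shows "(\<lambda>x. merge_gap n (f x) (g x) (h x)) \<in> borel_measurable M"
  unfolding merge_gap_def by measurable

lemma measurable_merge_limit [measurable (raw)]:
  assumes [measurable]: "f \<in> M \<rightarrow>\<^sub>M borel" "g \<in> M \<rightarrow>\<^sub>M borel" "h \<in> M \<rightarrow>\<^sub>M borel"
  shows "(\<lambda>x. merge_limit (f x) (g x) (h x)) \<in> borel_measurable M"
  unfolding merge_limit_def by measurable

lemma tail_diff_le_merge_limit:
  assumes "A \<in> tail_field"
  shows "measure (law z y) A - measure (law z' y) A \<le> merge_limit z z' y"
  by (rule LIMSEQ_le_const[OF merge_gap_tendsto])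
    (use measure_law_diff_le_merge_gap[OF sets_tail_field[OF assms]] in auto)

text \<open>By \<open>measure_law_diff_le_merge_gap\<close> the event that the time-\<open>n\<close>
  state lies in the Hahn set maximises the difference over all events about times from
  \<open>n\<close> on, not just over events about time \<open>n\<close>. This is the maximality that
  \<open>tail_maximiser\<close> requires.\<close>

lemma merge_limit_eq_0:
  assumes "\<And>A. A \<in> tail_field \<Longrightarrow> measure (law z y) A = measure (law z' y) A"
  shows "merge_limit z z' y = 0"
proof -
  have "\<exists>Y\<in>sets borel. measure (marginal n z y) Y - measure (marginal n z' y) Y = merge_gap n z z' y" for n
    by (rule set_gap_Hahn[OF prob_space_marginal prob_space_marginal, of z' y n z y n])
      (auto simp: sets_marginal merge_gap_def)
  then obtain Y where Y: "\<And>n. Y n \<in> sets borel"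
    and eq: "\<And>n. measure (marginal n z y) (Y n) - measure (marginal n z' y) (Y n) = merge_gap n z z' y"
    by metis
  let ?B = "\<lambda>n. (\<lambda>x. x (int n)) -` Y n"
  note eq = eq[unfolded measure_marginal[OF Y]]
  have "\<exists>A\<in>tail_field. merge_limit z z' y \<le> measure (law z y) A - measure (law z' y) A"
    by (rule tail_maximiser[where B = ?B])
      (auto simp: prob_space_law sets_law eq intro: coord_vimage_sets[OF Y] measure_law_diff_le_merge_gap
        merge_limit_le)
  then show ?thesis using assms merge_limit_nonneg[of z z' y] by force
qed

text \<open>A weak form of Levy's zero-one law, for which approximating \<open>A\<close> by cylinder events suffices.\<close>
lemma conditional_tail_probability_near_1:
  assumes A: "A \<in> tail_field" and pos: "0 < measure (law z y) A" and d: "0 < d" "d < 1"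
  shows "\<exists>m. \<forall>n\<ge>m. 0 < measure (marginal n z y)
    {u. 1 - d < measure (law u ((path_shift ^^ n) y)) (path_delay n -` A)}"
proof -
  interpret P: prob_space "law z y" by (rule prob_space_law)
  \<comment> \<open>Chosen so that 2e = d P(A). The estimates P(A) - e < P(A \<inter> B) \<le> (1 -
    d) P(B) \<le> (1 - d) (P(A) + e) would give d P(A) + d e < 2e, which is impossible.\<close>
  define e where "e = d * measure (law z y) A / 2"
  have e: "0 < e" using pos d by (simp add: e_def)
  have "\<exists>B\<in>(\<Union>n::nat. sets (coord_field {0..int n})). measure (law z y) (sym_diff A B) < e"
    by (rule P.measure_approx_algebra)
      (use algebra_coord_field_union sets_coord_field_generated sets_tail_field[OF A, of 0] e
       in \<open>auto simp: sets_law\<close>)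
  then obtain B and m :: nat where B: "B \<in> sets (coord_field {0..int m})"
    and AB: "measure (law z y) (sym_diff A B) < e" by blast
  have A0[measurable]: "A \<in> sets (law z y)" using sets_tail_field[OF A, of 0] by (simp add: sets_law)
  have B0[measurable]: "B \<in> sets (law z y)"
    using B sets_coord_field_mono[of "{0..int m}" "{0..}"] by (auto simp: sets_law)
  have "measure (law z y) A \<le> measure (law z y) (A \<inter> B \<union> sym_diff A B)"
    by (rule P.finite_measure_mono) auto
  also have "\<dots> \<le> measure (law z y) (A \<inter> B) + measure (law z y) (sym_diff A B)"
    by (rule measure_Un_le) auto
  finally have 1: "measure (law z y) A - e < measure (law z y) (A \<inter> B)" using AB by simp
  have "measure (law z y) B \<le> measure (law z y) (A \<union> sym_diff A B)"
    by (rule P.finite_measure_mono) auto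
  also have "\<dots> \<le> measure (law z y) A + measure (law z y) (sym_diff A B)"
    by (rule measure_Un_le) auto
  finally have 2: "measure (law z y) B < measure (law z y) A + e" using AB by simp
  show ?thesis
  \<comment> \<open>The horizon of the approximating event \<open>B\<close> serves as threshold: for
    later \<open>n\<close>, \<open>B\<close> still belongs to the past and the Markov property at
    time \<open>n\<close> applies to it.\<close>
  proof (intro exI[of _ m] allI impI, rule ccontr)
    fix n assume n: "m \<le> n"
    let ?h = "\<lambda>u. measure (law u ((path_shift ^^ n) y)) (path_delay n -` A)"
    have h[measurable]: "?h \<in> borel_measurable borel"
      by (rule measurable_measure_law[OF path_delay_vimage_sets[OF sets_tail_field[OF A]]])
    have S: "{u. 1 - d < ?h u} \<in> sets borel" by measurable
    interpret p: prob_space "marginal n z y" by (rule prob_space_marginal)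
    assume "\<not> 0 < measure (marginal n z y) {u. 1 - d < ?h u}"
    then have "measure (marginal n z y) {u. 1 - d < ?h u} = 0"
      using measure_nonneg[of "marginal n z y" "{u. 1 - d < ?h u}"] by linarith
    then have "AE u in marginal n z y. \<not> 1 - d < ?h u"
      using S by (intro AE_I[of _ _ "{u. 1 - d < ?h u}"]) (auto simp: p.emeasure_eq_measure sets_marginal)
    then have "AE x in law z y. \<not> 1 - d < ?h (x (int n))"
      unfolding quenched_marginal_def by (subst (asm) AE_distr_iff) (auto simp: S)
    then have ae: "AE x in law z y. indicator B x * ?h (x (int n)) \<le> (1 - d) * indicator B x"
      by eventually_elim (auto simp: indicator_def)
    have hx[measurable]: "(\<lambda>x. ?h (x (int n))) \<in> borel_measurable (law z y)"
      by (rule measurable_compose[OF measurable_coord_law h])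
    have "B \<in> sets (coord_field {0..int n})"
      using B n sets_coord_field_mono[of "{0..int m}" "{0..int n}"] by auto
    then have "measure (law z y) (A \<inter> B) = (\<integral>x. indicator B x * ?h (x (int n)) \<partial>law z y)"
      by (rule measure_law_Markov[OF sets_tail_field[OF A]])
    also have "\<dots> \<le> (\<integral>x. (1 - d) * indicator B x \<partial>law z y)"
      using ae by (intro integral_mono_AE P.integrable_const_bound[where B=1])
        (use d in \<open>auto simp: indicator_def prob_space.prob_le_1[OF prob_space_law]\<close>)
    also have "\<dots> = (1 - d) * measure (law z y) B" by simp
    also have "\<dots> \<le> (1 - d) * (measure (law z y) A + e)"
      using 2 d by (intro mult_left_mono) auto
    finally have "measure (law z y) A - e < (1 - d) * (measure (law z y) A + e)"
      using 1 by simp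
    then have "d * measure (law z y) A + d * e < 2 * e" by (simp add: algebra_simps)
    moreover have "2 * e = d * measure (law z y) A" by (simp add: e_def)
    moreover have "0 < d * e" using d e by simp
    ultimately show False by linarith
  qed
qed

end

section \<open>The stationary two-point motion\<close>

lemma measurable_fst_snd_borel [measurable]:
  "(fst :: 'a::topological_space \<times> 'b::topological_space \<Rightarrow> 'a) \<in> borel \<rightarrow>\<^sub>M borel"
  "(snd :: 'a::topological_space \<times> 'b::topological_space \<Rightarrow> 'b) \<in> borel \<rightarrow>\<^sub>M borel"
  by (intro borel_measurable_continuous_onI continuous_intros)+

text \<open>Invariance under the two-point motion is checked by integrating kernel values, so the
  formula is required for functions; membership in \<open>prob_algebra\<close> is the form in which
  the rules for \<open>bind\<close> take a measure.\<close>

lemma nn_integral_pair_mixture: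
  fixes \<mu> :: "(int \<Rightarrow> 'f::polish_space) \<Rightarrow> 'e::polish_space measure"
  assumes mu[measurable]: "\<mu> \<in> borel \<rightarrow>\<^sub>M prob_algebra borel"
    and PY: "PY \<in> space (prob_algebra borel)"
  shows "f \<in> borel_measurable borel \<Longrightarrow>
      (\<integral>\<^sup>+w. f w \<partial>pair_mixture \<mu> PY) = (\<integral>\<^sup>+y. \<integral>\<^sup>+z'. \<integral>\<^sup>+z. f (z, z', y) \<partial>\<mu> y \<partial>\<mu> y \<partial>PY)"
    and pair_mixture_in_prob_algebra: "pair_mixture \<mu> PY \<in> space (prob_algebra borel)"
proof -
  have sets_mu[measurable_cong]: "sets (\<mu> y) = sets borel" for y
    using measurable_space[OF mu, of y] by (simp add: space_prob_algebra)
  have sets_PY[measurable_cong]: "sets PY = sets borel"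
    using PY by (simp add: space_prob_algebra)
  define K3 where "K3 y z' z = return borel (z, z', y)" for y :: "int \<Rightarrow> 'f" and z' z :: 'e
  define K2 where "K2 y z' = \<mu> y \<bind> K3 y z'" for y z'
  define K1 where "K1 y = \<mu> y \<bind> K2 y" for y
  have K3: "(\<lambda>(p, z). K3 (fst p) (snd p) z) \<in> (borel \<Otimes>\<^sub>M borel) \<Otimes>\<^sub>M borel \<rightarrow>\<^sub>M prob_algebra borel"
    unfolding K3_def split_beta'
    by (rule measurable_compose[OF _ measurable_return_prob_space]) measurable
  have K2: "(\<lambda>(y, z'). K2 y z') \<in> borel \<Otimes>\<^sub>M borel \<rightarrow>\<^sub>M prob_algebra borel"
    unfolding K2_def split_beta'
    by (rule measurable_bind_prob_space2[OF _ K3]) measurable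
  have K1: "K1 \<in> borel \<rightarrow>\<^sub>M prob_algebra borel"
    unfolding K1_def by (rule measurable_bind_prob_space2[OF mu K2])
  have pm: "pair_mixture \<mu> PY = PY \<bind> K1"
    by (simp add: pair_mixture_def K1_def[abs_def] K2_def[abs_def] K3_def[abs_def])
  show "pair_mixture \<mu> PY \<in> space (prob_algebra borel)"
    unfolding pm space_prob_algebra using prob_space_bind'[OF PY K1] sets_bind'[OF PY K1] by simp
  have "K3 y z' \<in> \<mu> y \<rightarrow>\<^sub>M subprob_algebra borel" for y z'
    using measurable_prob_algebraD[OF measurable_compose[OF measurable_Pair1' K3, of "(y, z')"]]
    by (simp cong: measurable_cong_sets add: sets_mu space_pair_measure)
  moreover have "K2 y \<in> \<mu> y \<rightarrow>\<^sub>M subprob_algebra borel" for y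
    using measurable_prob_algebraD[OF measurable_compose[OF measurable_Pair1' K2, of y]]
    by (simp cong: measurable_cong_sets add: sets_mu)
  moreover have "K1 \<in> PY \<rightarrow>\<^sub>M subprob_algebra borel"
    using measurable_prob_algebraD[OF K1] by (simp cong: measurable_cong_sets add: sets_PY)
  ultimately show "(\<integral>\<^sup>+w. f w \<partial>pair_mixture \<mu> PY)
      = (\<integral>\<^sup>+y. \<integral>\<^sup>+z'. \<integral>\<^sup>+z. f (z, z', y) \<partial>\<mu> y \<partial>\<mu> y \<partial>PY)"
    if f[measurable]: "f \<in> borel_measurable borel"
    unfolding pm
    by (simp add: nn_integral_bind[OF f] K1_def K2_def) (simp add: K3_def nn_integral_return)
qed

context quenched_chain
begin

lemma emeasure_marginal:
  "U \<in> sets borel \<Longrightarrow> emeasure (marginal n z y) U = emeasure (law z y) ((\<lambda>x. x (int n)) -` U)"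
  unfolding quenched_marginal_def by (simp add: emeasure_distr)

lemma marginal_0: "marginal 0 z y = return borel z"
proof (rule measure_eqI)
  fix U assume "U \<in> sets (marginal 0 z y)"
  then have U: "U \<in> sets borel" by (simp add: sets_marginal)
  then have A: "(\<lambda>x. x (int 0)) -` U \<in> sets (coord_field {0..int 0})"
    unfolding sets_coord_field by (intro sigma_sets.Basic) auto
  have "emeasure (marginal 0 z y) U = emeasure (law z y) ((\<lambda>x. x (int 0)) -` U)"
    by (rule emeasure_marginal[OF U])
  also have "\<dots> = indicator U z"
    unfolding emeasure_law[OF A] by (simp add: indicator_def)
  finally show "emeasure (marginal 0 z y) U = emeasure (return borel z) U"
    using U by simp
qed (simp add: sets_marginal)

lemma marginal_1: "marginal 1 z y = PX z y"
proof (rule measure_eqI)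
  fix U assume "U \<in> sets (marginal 1 z y)"
  then have U: "U \<in> sets borel" by (simp add: sets_marginal)
  have A: "(\<lambda>x. x (int 1)) -` U \<in> sets (coord_field {0..int 1})"
    unfolding sets_coord_field using U by (intro sigma_sets.Basic CollectI exI[of _ "int 1"] exI[of _ U]) auto
  have "emeasure (marginal 1 z y) U = emeasure (law z y) ((\<lambda>x. x (int 1)) -` U)"
    by (rule emeasure_marginal[OF U])
  also have "\<dots> = (\<integral>\<^sup>+w. indicator U w \<partial>PX z y)"
    unfolding emeasure_law[OF A] by (simp add: indicator_def)
  finally show "emeasure (marginal 1 z y) U = emeasure (PX z y) U"
    using U by (simp add: sets_PX)
qed (simp add: sets_marginal sets_PX)

lemma marginal_Suc: "marginal (Suc n) z y = marginal n z y \<bind> (\<lambda>u. PX u ((path_shift ^^ n) y))"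
proof (rule measure_eqI)
  have K: "(\<lambda>u. PX u ((path_shift ^^ n) y)) \<in> borel \<rightarrow>\<^sub>M prob_algebra borel" by measurable
  have M: "marginal n z y \<in> space (prob_algebra borel)"
    by (simp add: space_prob_algebra prob_space_marginal sets_marginal)
  interpret bd: prob_space "marginal n z y \<bind> (\<lambda>u. PX u ((path_shift ^^ n) y))"
    by (rule prob_space_bind'[OF M K])
  show "sets (marginal (Suc n) z y) = sets (marginal n z y \<bind> (\<lambda>u. PX u ((path_shift ^^ n) y)))"
    using sets_bind'[OF M K] by (simp add: sets_marginal)
  fix U assume "U \<in> sets (marginal (Suc n) z y)"
  then have U: "U \<in> sets borel" by (simp add: sets_marginal)
  have "measure (marginal (n + 1) z y) U = (\<integral>u. measure (PX u ((path_shift ^^ n) y)) U \<partial>marginal n z y)"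
    unfolding measure_marginal_add[OF U] marginal_1 ..
  also have "\<dots> = measure (marginal n z y \<bind> (\<lambda>u. PX u ((path_shift ^^ n) y))) U"
    using measurable_prob_algebraD[OF K] U
    by (intro subprob_space.measure_bind[symmetric, where N=borel] prob_space_imp_subprob_space prob_space_marginal)
      (auto cong: measurable_cong_sets simp: sets_marginal)
  finally show "emeasure (marginal (Suc n) z y) U
      = emeasure (marginal n z y \<bind> (\<lambda>u. PX u ((path_shift ^^ n) y))) U"
    by (simp add: bd.emeasure_eq_measure finite_measure.emeasure_eq_measure[OF prob_space.finite_measure[OF prob_space_marginal]])
qed

text \<open>The \<open>n\<close>-step transition of the two-point motion, built from the
  time-\<open>n\<close> marginals instead of by iterating single steps. The environment component
  moves deterministically and is shared by both copies.\<close>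

definition pair_kernel :: "nat \<Rightarrow> 'e \<times> 'e \<times> (int \<Rightarrow> 'f) \<Rightarrow> ('e \<times> 'e \<times> (int \<Rightarrow> 'f)) measure" where
  "pair_kernel n = (\<lambda>(z, z', y). distr (marginal n z y \<Otimes>\<^sub>M marginal n z' y) borel
     (\<lambda>(u, u'). (u, u', (path_shift ^^ n) y)))"

lemma pair_prob_space_marginal: "pair_prob_space (marginal n z y) (marginal n z' y)"
  by (simp add: pair_prob_space_def pair_sigma_finite_def prob_space_marginal
      prob_space_imp_sigma_finite)

lemma measurable_pair_kernel [measurable]: "pair_kernel n \<in> borel \<rightarrow>\<^sub>M prob_algebra borel"
  unfolding pair_kernel_def split_beta'
  by (rule measurable_distr_prob_space2[where M="borel \<Otimes>\<^sub>M borel"]) (auto simp: split_beta')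

lemma measurable_triple [measurable]:
  "(\<lambda>(u, u'). (u, u', c)) \<in> borel \<Otimes>\<^sub>M borel \<rightarrow>\<^sub>M (borel :: ('a::second_countable_topology
    \<times> 'b::second_countable_topology \<times> 'c::second_countable_topology) measure)"
  unfolding split_beta' by measurable

lemma measurable_triple_marginal [measurable]:
  "(\<lambda>(u, u'). (u, u', c)) \<in> marginal n z y \<Otimes>\<^sub>M marginal n z' y \<rightarrow>\<^sub>M
    (borel :: ('e \<times> 'e \<times> (int \<Rightarrow> 'f)) measure)"
  by (simp cong: measurable_cong_sets sets_pair_measure_cong add: sets_marginal measurable_triple)

lemma integral_pair_kernel:
  fixes f :: "_ \<Rightarrow> real"
  assumes "f \<in> borel_measurable borel"
  shows "(\<integral>v. f v \<partial>pair_kernel n (z, z', y))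
    = (\<integral>q. f (fst q, snd q, (path_shift ^^ n) y) \<partial>(marginal n z y \<Otimes>\<^sub>M marginal n z' y))"
  unfolding pair_kernel_def prod.case
  by (subst integral_distr[OF measurable_triple_marginal]) (use assms in \<open>auto simp: split_beta'\<close>)

lemma nn_integral_pair_kernel:
  assumes f: "f \<in> borel_measurable borel"
  shows "(\<integral>\<^sup>+v. f v \<partial>pair_kernel n (z, z', y))
    = (\<integral>\<^sup>+u'. \<integral>\<^sup>+u. f (u, u', (path_shift ^^ n) y) \<partial>marginal n z y \<partial>marginal n z' y)"
proof -
  interpret pair_prob_space "marginal n z y" "marginal n z' y" by (rule pair_prob_space_marginal)
  show ?thesis
    using nn_integral_distr[OF measurable_triple_marginal, of f] f
      nn_integral_snd[OF measurable_compose[OF measurable_triple_marginal f]]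
    by (simp add: pair_kernel_def split_beta')
qed

lemma AE_pair_kernel:
  assumes "Measurable.pred borel Q"
  shows "(AE v in pair_kernel n (z, z', y). Q v) \<longleftrightarrow>
    (AE q in marginal n z y \<Otimes>\<^sub>M marginal n z' y. Q (fst q, snd q, (path_shift ^^ n) y))"
  unfolding pair_kernel_def prod.case
  by (subst AE_distr_iff[OF measurable_triple_marginal]) (use assms in \<open>auto simp: split_beta' pred_def\<close>)

text \<open>Conditionally on time \<open>n\<close>, the difference of the laws at time \<open>n + k\<close> is the average of the
  differences started from two independent copies.\<close>
lemma merge_gap_add_le:
  "merge_gap (n + k) z z' y \<le> (\<integral>(u, u', y'). merge_gap k u u' y' \<partial>pair_kernel n (z, z', y))"
proof -
  let ?p = "marginal n z y" and ?q = "marginal n z' y" and ?y = "(path_shift ^^ n) y"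
  interpret pq: pair_prob_space ?p ?q by (rule pair_prob_space_marginal)
  have rhs: "(\<integral>(u, u', y'). merge_gap k u u' y' \<partial>pair_kernel n (z, z', y))
      = (\<integral>q. merge_gap k (fst q) (snd q) ?y \<partial>(?p \<Otimes>\<^sub>M ?q))"
    by (subst integral_pair_kernel) (auto simp: split_beta')
  have "measure (marginal (n + k) z y) U - measure (marginal (n + k) z' y) U
      \<le> (\<integral>q. merge_gap k (fst q) (snd q) ?y \<partial>(?p \<Otimes>\<^sub>M ?q))" if U: "U \<in> sets borel" for U
  proof -
    let ?f = "\<lambda>u. measure (marginal k u ?y) U"
    have f[measurable]: "?f \<in> borel_measurable borel"
      by (rule measurable_compose[OF _ measurable_measure_prob_algebra[OF U]]) measurable
    have f1: "0 \<le> ?f u" "?f u \<le> 1" for u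
      by (auto simp: prob_space.prob_le_1[OF prob_space_marginal])
    have ip: "integrable ?p ?f" "integrable ?q ?f"
      using f1 f by (auto intro!: pq.M1.integrable_const_bound[where B=1] pq.M2.integrable_const_bound[where B=1]
        simp: sets_marginal cong: measurable_cong_sets)
    have ipq: "integrable (?p \<Otimes>\<^sub>M ?q) (\<lambda>q. ?f (fst q) - ?f (snd q))"
      using f1 by (intro pq.P.integrable_const_bound[where B=1]) (auto simp: abs_le_iff intro!: AE_I2, (smt (verit) f1)+)
    have "measure (marginal (n + k) z y) U - measure (marginal (n + k) z' y) U
        = (\<integral>u. ?f u \<partial>?p) - (\<integral>u. ?f u \<partial>?q)"
      by (simp add: measure_marginal_add[OF U])
    also have "\<dots> = (\<integral>u. \<integral>u'. ?f u - ?f u' \<partial>?q \<partial>?p)"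
      using ip pq.M1.prob_space pq.M2.prob_space by simp
    also have "\<dots> = (\<integral>q. ?f (fst q) - ?f (snd q) \<partial>(?p \<Otimes>\<^sub>M ?q))"
      using pq.integral_fst'[OF ipq] by simp
    also have "\<dots> \<le> (\<integral>q. merge_gap k (fst q) (snd q) ?y \<partial>(?p \<Otimes>\<^sub>M ?q))"
    proof (rule integral_mono[OF ipq])
      show "integrable (?p \<Otimes>\<^sub>M ?q) (\<lambda>q. merge_gap k (fst q) (snd q) ?y)"
        by (intro pq.P.integrable_const_bound[where B=1] AE_I2)
          (auto simp: merge_gap_nonneg merge_gap_le_1)
      show "?f (fst q) - ?f (snd q) \<le> merge_gap k (fst q) (snd q) ?y" for q
        unfolding merge_gap_def using U
        by (intro set_gap_upper prob_space_marginal) (simp add: sets_marginal)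
    qed
    finally show ?thesis .
  qed
  then show ?thesis
    unfolding rhs merge_gap_def[of "n + k"] set_gap_def[of "marginal (n + k) z y"]
    by (intro cSUP_least) (auto simp: sets_marginal)
qed

lemma prob_space_pair_kernel: "prob_space (pair_kernel n w)"
  and sets_pair_kernel: "sets (pair_kernel n w) = sets borel"
  using measurable_space[OF measurable_pair_kernel, of w n] by (auto simp: space_prob_algebra)

definition triple_merge_limit :: "'e \<times> 'e \<times> (int \<Rightarrow> 'f) \<Rightarrow> real" where
  "triple_merge_limit = (\<lambda>(z, z', y). merge_limit z z' y)"

lemma measurable_triple_merge_limit [measurable]: "triple_merge_limit \<in> borel_measurable borel"
  and measurable_triple_merge_gap: "(\<lambda>(z, z', y). merge_gap n z z' y) \<in> borel_measurable borel"
  unfolding triple_merge_limit_def split_beta' by measurable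

text \<open>The submartingale inequality, obtained by letting \<open>k\<close> tend to infinity in
  \<open>merge_gap_add_le\<close>: the left side there never falls below the limit, and dominated
  convergence handles the right side.\<close>

lemma triple_merge_limit_le_integral:
  "triple_merge_limit w \<le> (\<integral>v. triple_merge_limit v \<partial>pair_kernel n w)"
proof -
  obtain z z' y where w: "w = (z, z', y)" by (cases w)
  interpret K: prob_space "pair_kernel n w" by (rule prob_space_pair_kernel)
  note sets_pair_kernel[measurable_cong]
  have "(\<lambda>k. \<integral>(u, u', y'). merge_gap k u u' y' \<partial>pair_kernel n w)
      \<longlonglongrightarrow> (\<integral>v. triple_merge_limit v \<partial>pair_kernel n w)"
    using measurable_triple_merge_gap measurable_triple_merge_limit[unfolded triple_merge_limit_def]
    by (intro integral_dominated_convergence[where w="\<lambda>_. 1"] AE_I2)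
      (auto simp: triple_merge_limit_def merge_gap_nonneg merge_gap_le_1 intro: merge_gap_tendsto
        cong: measurable_cong_sets)
  then show ?thesis
  proof (rule LIMSEQ_le_const, intro exI[of _ 0] allI impI)
    fix k
    show "triple_merge_limit w \<le> (\<integral>(u, u', y'). merge_gap k u u' y' \<partial>pair_kernel n w)"
      using merge_limit_le[of z z' y "n + k"] merge_gap_add_le[of n k z z' y]
      by (simp add: w triple_merge_limit_def)
  qed
qed

text \<open>Constancy is assumed for every \<open>n\<close> because the time at which the
  contradiction arises depends on \<open>A\<close>. The one-sided alternative becomes triviality
  once it is applied to the complement as well.\<close>

lemma tail_zero_one:
  assumes const: "\<And>n. AE v in pair_kernel n (z, z', y). triple_merge_limit v = triple_merge_limit (z, z', y)"
    and lt: "merge_limit z z' y < 1" and A: "A \<in> tail_field"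
  shows "measure (law z y) A = 0 \<or> measure (law z' y) A = 1"
proof (rule ccontr)
  assume neg: "\<not> (measure (law z y) A = 0 \<or> measure (law z' y) A = 1)"
  interpret P: prob_space "law z y" by (rule prob_space_law)
  interpret P': prob_space "law z' y" by (rule prob_space_law)
  have compl: "measure (law v y') (- B) = 1 - measure (law v y') B" if "B \<in> tail_field" for v y' B
    using prob_space.prob_compl[OF prob_space_law, of B v y'] sets_tail_field[OF that, of 0]
    by (simp add: sets_law Compl_eq_Diff_UNIV)
  have pos: "0 < measure (law z y) A" "0 < measure (law z' y) (- A)"
    using neg P'.prob_le_1[of A] measure_nonneg[of "law z y" A] compl[OF A, of z' y] by linarith+
  \<comment> \<open>With this \<open>d\<close>, conditional probabilities above 1 - d and below d
    differ by more than 1 - 2d, which is exactly the value of \<beta> at the starting point.\<close>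
  define d where "d = (1 - merge_limit z z' y) / 2"
  have d: "0 < d" "d < 1"
    using lt merge_limit_nonneg[of z z' y] by (auto simp: d_def)
  obtain m m' where
    m: "\<And>n. m \<le> n \<Longrightarrow> 0 < measure (marginal n z y)
      {u. 1 - d < measure (law u ((path_shift ^^ n) y)) (path_delay n -` A)}" and
    m': "\<And>n. m' \<le> n \<Longrightarrow> 0 < measure (marginal n z' y)
      {u. 1 - d < measure (law u ((path_shift ^^ n) y)) (path_delay n -` (- A))}"
    using conditional_tail_probability_near_1[OF A pos(1) d]
      conditional_tail_probability_near_1[OF Compl_tail_field[OF A] pos(2) d] by metis
  \<comment> \<open>Both positivity statements hold from some time on, so they can be used at a
    common time.\<close>
  define n where "n = max m m'"
  let ?y = "(path_shift ^^ n) y" and ?A = "path_delay n -` A"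
  let ?h = "\<lambda>u. measure (law u ?y) ?A"
  let ?S = "{u. 1 - d < ?h u}" and ?S' = "{u. ?h u < d}"
  let ?p = "marginal n z y" and ?q = "marginal n z' y"
  interpret pq: pair_prob_space ?p ?q by (rule pair_prob_space_marginal)
  note An = path_delay_tail_field[OF A, of n]
  have h[measurable]: "?h \<in> borel_measurable borel"
    by (rule measurable_measure_law) (use sets_tail_field[OF An, of 0] in simp)
  have S[measurable]: "?S \<in> sets borel" "?S' \<in> sets borel" by measurable
  have S_pos: "0 < measure ?p ?S" "0 < measure ?q ?S'"
    using m[of n] m'[of n] compl[OF An] by (simp_all add: n_def vimage_Compl)
  have "Measurable.pred borel (\<lambda>v. triple_merge_limit v = triple_merge_limit (z, z', y))"
    by measurable
  from const[of n, unfolded AE_pair_kernel[OF this]]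
  have "AE q in ?p \<Otimes>\<^sub>M ?q. merge_limit (fst q) (snd q) ?y = merge_limit z z' y"
    by (simp add: triple_merge_limit_def)
  then have "AE q in ?p \<Otimes>\<^sub>M ?q. q \<notin> ?S \<times> ?S'"
  proof eventually_elim
    case (elim q)
    show ?case
    proof
      assume "q \<in> ?S \<times> ?S'"
      then have "1 - 2 * d < ?h (fst q) - ?h (snd q)" by auto
      also have "\<dots> \<le> merge_limit z z' y"
        unfolding elim[symmetric] by (rule tail_diff_le_merge_limit[OF An])
      also have "\<dots> = 1 - 2 * d" by (simp add: d_def field_simps)
      finally show False by simp
    qed
  qed
  then have "emeasure (?p \<Otimes>\<^sub>M ?q) (?S \<times> ?S') = 0"
    by (subst (asm) AE_iff_measurable[where N="?S \<times> ?S'"]) (auto simp: space_pair_measure sets_marginal)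
  then have "emeasure ?p ?S * emeasure ?q ?S' = 0"
    using S by (subst (asm) pq.M2.emeasure_pair_measure_Times) (auto simp: sets_marginal)
  then show False
    using S_pos by (auto simp: pq.M1.emeasure_eq_measure pq.M2.emeasure_eq_measure)
qed

end

section \<open>Invariance of the two-point law\<close>

locale stationary_environment = quenched_chain PX
  for PX :: "'e::polish_space \<Rightarrow> (int \<Rightarrow> 'f::polish_space) \<Rightarrow> 'e measure" +
  fixes \<mu> :: "(int \<Rightarrow> 'f) \<Rightarrow> 'e measure" and PY :: "(int \<Rightarrow> 'f) measure"
  assumes mu_kernel [measurable]: "\<mu> \<in> borel \<rightarrow>\<^sub>M prob_algebra borel"
    and mu_invariant:
      "\<And>y A. A \<in> sets borel \<Longrightarrow> (\<integral>\<^sup>+ z. emeasure (PX z y) A \<partial>\<mu> y) = emeasure (\<mu> (path_shift y)) A"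
    and PY_prob: "PY \<in> space (prob_algebra borel)"
    and PY_invariant: "distr PY borel path_shift = PY"
begin

lemma mu_in_prob_algebra: "\<mu> y \<in> space (prob_algebra borel)"
  using measurable_space[OF mu_kernel, of y] by simp

lemma prob_space_mu: "prob_space (\<mu> y)" and sets_mu [measurable_cong]: "sets (\<mu> y) = sets borel"
  using mu_in_prob_algebra[of y] by (auto simp: space_prob_algebra)

lemma sets_PY [measurable_cong]: "sets PY = sets borel"
  using PY_prob by (simp add: space_prob_algebra)

text \<open>One-step invariance iterates: \<open>marginal_Suc\<close> appends a transition in the
  environment shifted by \<open>n\<close>, and by induction the mixture before it is already
  \<open>\<mu>\<close> at that environment.\<close>

lemma mu_bind_marginal: "\<mu> y \<bind> (\<lambda>z. marginal n z y) = \<mu> ((path_shift ^^ n) y)"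
proof (induction n)
  case 0
  show ?case by (simp add: marginal_0 bind_return'' sets_mu)
next
  case (Suc n)
  let ?y = "(path_shift ^^ n) y"
  have K: "(\<lambda>u. PX u ?y) \<in> borel \<rightarrow>\<^sub>M prob_algebra borel" by measurable
  have M: "(\<lambda>z. marginal n z y) \<in> borel \<rightarrow>\<^sub>M prob_algebra borel" by measurable
  have "\<mu> y \<bind> (\<lambda>z. marginal (Suc n) z y) = (\<mu> y \<bind> (\<lambda>z. marginal n z y)) \<bind> (\<lambda>u. PX u ?y)"
    unfolding marginal_Suc
    by (rule bind_assoc[symmetric, where N=borel and R=borel])
      (use measurable_prob_algebraD[OF M] measurable_prob_algebraD[OF K]
       in \<open>auto cong: measurable_cong_sets simp: sets_mu\<close>)
  also have "\<dots> = \<mu> ?y \<bind> (\<lambda>u. PX u ?y)" by (simp only: Suc)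
  also have "\<dots> = \<mu> (path_shift ?y)"
  proof (rule measure_eqI)
    show "sets (\<mu> ?y \<bind> (\<lambda>u. PX u ?y)) = sets (\<mu> (path_shift ?y))"
      using sets_bind'[OF mu_in_prob_algebra K] by (simp add: sets_mu)
    fix U assume "U \<in> sets (\<mu> ?y \<bind> (\<lambda>u. PX u ?y))"
    then have "U \<in> sets borel" using sets_bind'[OF mu_in_prob_algebra K] by simp
    then show "emeasure (\<mu> ?y \<bind> (\<lambda>u. PX u ?y)) U = emeasure (\<mu> (path_shift ?y)) U"
      by (simp add: emeasure_bind_prob_algebra[OF mu_in_prob_algebra K] mu_invariant)
  qed
  finally show ?case by simp
qed

lemma nn_integral_mu_marginal:
  assumes "f \<in> borel_measurable borel"
  shows "(\<integral>\<^sup>+z. \<integral>\<^sup>+u. f u \<partial>marginal n z y \<partial>\<mu> y) = (\<integral>\<^sup>+u. f u \<partial>\<mu> ((path_shift ^^ n) y))"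
proof -
  have "(\<lambda>z. marginal n z y) \<in> borel \<rightarrow>\<^sub>M prob_algebra borel" by measurable
  then have "(\<lambda>z. marginal n z y) \<in> \<mu> y \<rightarrow>\<^sub>M subprob_algebra borel"
    by (simp add: measurable_prob_algebraD sets_mu cong: measurable_cong_sets)
  from nn_integral_bind[OF assms this] show ?thesis by (simp add: mu_bind_marginal)
qed

lemma distr_PY_funpow: "distr PY borel (path_shift ^^ n) = PY"
proof (induction n)
  case 0
  show ?case using distr_id2[of borel PY] sets_PY by (simp add: id_def)
next
  case (Suc n)
  have "distr PY borel (path_shift ^^ Suc n) = distr (distr PY borel (path_shift ^^ n)) borel path_shift"
    by (subst distr_distr) (auto simp: comp_def)
  then show ?case by (simp only: Suc PY_invariant)
qed

abbreviation "stationary_law \<equiv> pair_mixture \<mu> PY"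

lemmas stationary_law_in_prob_algebra = pair_mixture_in_prob_algebra[OF mu_kernel PY_prob]

text \<open>Averaging \<open>z\<close> and then \<open>z'\<close> over \<open>\<mu> y\<close> turns
  each time-\<open>n\<close> marginal into \<open>\<mu>\<close> at the shifted environment; the
  invariance of \<open>PY\<close> then absorbs the shift.\<close>

lemma stationary_law_invariant: "stationary_law \<bind> pair_kernel n = stationary_law"
proof (rule measure_eqI)
  show "sets (stationary_law \<bind> pair_kernel n) = sets stationary_law"
    using sets_bind'[OF stationary_law_in_prob_algebra measurable_pair_kernel, of n] stationary_law_in_prob_algebra by (simp add: space_prob_algebra)
  fix A assume "A \<in> sets (stationary_law \<bind> pair_kernel n)"
  then have A[measurable]: "A \<in> sets borel"
    using sets_bind'[OF stationary_law_in_prob_algebra measurable_pair_kernel, of n] by simp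
  define I :: "'e \<Rightarrow> 'e \<Rightarrow> (int \<Rightarrow> 'f) \<Rightarrow> ennreal" where "I u u' y = indicator A (u, u', y)" for u u' y
  have I[measurable]: "(\<lambda>x. I (f x) (g x) (h x)) \<in> borel_measurable M"
    if [measurable]: "f \<in> M \<rightarrow>\<^sub>M borel" "g \<in> M \<rightarrow>\<^sub>M borel" "h \<in> M \<rightarrow>\<^sub>M borel"
    for f g h and M :: "'x measure"
    unfolding I_def by measurable
  define G where "G y = (\<integral>\<^sup>+u'. \<integral>\<^sup>+u. I u u' y \<partial>\<mu> y \<partial>\<mu> y)" for y
  have G: "G \<in> borel_measurable borel"
  proof -
    have "(\<lambda>p. \<integral>\<^sup>+u. I u (snd p) (fst p) \<partial>\<mu> (fst p)) \<in> borel_measurable (borel \<Otimes>\<^sub>M borel)"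
      by (rule nn_integral_measurable_subprob_algebra2[where N=borel])
        (auto simp: split_beta' intro!: measurable_prob_algebraD I)
    then show ?thesis
      unfolding G_def
      by (intro nn_integral_measurable_subprob_algebra2[where N=borel] measurable_prob_algebraD[OF mu_kernel])
        (simp add: split_beta')
  qed
  have step: "(\<integral>\<^sup>+z'. \<integral>\<^sup>+z. emeasure (pair_kernel n (z, z', y)) A \<partial>\<mu> y \<partial>\<mu> y) = G ((path_shift ^^ n) y)" for y
  proof -
    let ?y = "(path_shift ^^ n) y"
    have "(\<integral>\<^sup>+z. emeasure (pair_kernel n (z, z', y)) A \<partial>\<mu> y)
        = (\<integral>\<^sup>+u'. \<integral>\<^sup>+u. I u u' ?y \<partial>\<mu> ?y \<partial>marginal n z' y)" for z'
    proof -
      interpret pair_prob_space "marginal n z' y" "\<mu> y"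
        by (simp add: pair_prob_space_def pair_sigma_finite_def prob_space_marginal
            prob_space_mu prob_space_imp_sigma_finite)
      have m: "(\<lambda>(u', z). \<integral>\<^sup>+u. I u u' ?y \<partial>marginal n z y) \<in> borel_measurable (borel \<Otimes>\<^sub>M borel)"
        unfolding split_beta'
        by (rule nn_integral_measurable_subprob_algebra2[where N=borel])
          (auto simp: split_beta' intro!: measurable_prob_algebraD I)
      have "emeasure (pair_kernel n (z, z', y)) A
          = (\<integral>\<^sup>+u'. \<integral>\<^sup>+u. I u u' ?y \<partial>marginal n z y \<partial>marginal n z' y)" for z
        unfolding I_def by (subst nn_integral_pair_kernel[symmetric]) (auto simp: sets_pair_kernel)
      then have "(\<integral>\<^sup>+z. emeasure (pair_kernel n (z, z', y)) A \<partial>\<mu> y)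
          = (\<integral>\<^sup>+z. \<integral>\<^sup>+u'. \<integral>\<^sup>+u. I u u' ?y \<partial>marginal n z y \<partial>marginal n z' y \<partial>\<mu> y)" by simp
      \<comment> \<open>Exchanging \<open>z\<close> and \<open>u'\<close> places the average over
        \<open>z\<close> directly around its own marginal, so that
        \<open>nn_integral_mu_marginal\<close> applies.\<close>
      also have "\<dots> = (\<integral>\<^sup>+u'. \<integral>\<^sup>+z. \<integral>\<^sup>+u. I u u' ?y \<partial>marginal n z y \<partial>\<mu> y \<partial>marginal n z' y)"
        by (rule Fubini') (use m in \<open>simp cong: measurable_cong_sets sets_pair_measure_cong add: sets_marginal sets_mu\<close>)
      also have "\<dots> = (\<integral>\<^sup>+u'. \<integral>\<^sup>+u. I u u' ?y \<partial>\<mu> ?y \<partial>marginal n z' y)"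
        by (intro nn_integral_cong nn_integral_mu_marginal I) auto
      finally show ?thesis .
    qed
    then have "(\<integral>\<^sup>+z'. \<integral>\<^sup>+z. emeasure (pair_kernel n (z, z', y)) A \<partial>\<mu> y \<partial>\<mu> y)
        = (\<integral>\<^sup>+z'. \<integral>\<^sup>+u'. \<integral>\<^sup>+u. I u u' ?y \<partial>\<mu> ?y \<partial>marginal n z' y \<partial>\<mu> y)" by simp
    also have "\<dots> = G ?y"
      unfolding G_def
      by (rule nn_integral_mu_marginal, rule nn_integral_measurable_subprob_algebra2[where N=borel])
        (auto simp: split_beta' intro!: measurable_prob_algebraD I)
    finally show ?thesis .
  qed
  have "emeasure (stationary_law \<bind> pair_kernel n) A = (\<integral>\<^sup>+w. emeasure (pair_kernel n w) A \<partial>stationary_law)"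
    by (rule emeasure_bind_prob_algebra[OF stationary_law_in_prob_algebra measurable_pair_kernel A])
  also have "\<dots> = (\<integral>\<^sup>+y. G ((path_shift ^^ n) y) \<partial>PY)"
    by (subst nn_integral_pair_mixture[OF mu_kernel PY_prob])
      (auto simp: step intro: measurable_compose[OF measurable_prob_algebraD[OF measurable_pair_kernel]
        measurable_emeasure_subprob_algebra[OF A]])
  also have "\<dots> = (\<integral>\<^sup>+y. G y \<partial>distr PY borel (path_shift ^^ n))"
    by (rule nn_integral_distr[symmetric]) (use G in auto)
  also have "\<dots> = emeasure stationary_law A"
    unfolding distr_PY_funpow G_def I_def
    by (rule emeasure_pair_mixture[OF mu_kernel PY_prob A, symmetric])
  finally show "emeasure (stationary_law \<bind> pair_kernel n) A = emeasure stationary_law A" .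
qed

text \<open>Placing the quantifier over \<open>n\<close> inside costs countably many null sets. The
  resulting set of starting points refers to no tail event and can therefore be shared by all of
  them.\<close>

lemma AE_merge_limit_const:
  "AE w in stationary_law. \<forall>n. AE v in pair_kernel n w. triple_merge_limit v = triple_merge_limit w"
  unfolding AE_all_countable
proof
  fix n
  show "AE w in stationary_law. AE v in pair_kernel n w. triple_merge_limit v = triple_merge_limit w"
    by (rule stationary_submartingale_AE_const[OF stationary_law_in_prob_algebra
          measurable_pair_kernel stationary_law_invariant measurable_triple_merge_limit])
      (auto simp: triple_merge_limit_le_integral,
       auto simp: triple_merge_limit_def merge_limit_nonneg merge_limit_le_1)
qed

end

section \<open>Equivalence of merging, tail triviality and non-singularity\<close>

theorem theorem2p3:
  fixes PX :: "'e::polish_space \<Rightarrow> (int \<Rightarrow> 'f::polish_space) \<Rightarrow> 'e measure"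
    and \<mu> :: "(int \<Rightarrow> 'f) \<Rightarrow> 'e measure"
    and PY :: "(int \<Rightarrow> 'f) measure"
  assumes PX_kernel: "(\<lambda>(z, y). PX z y) \<in> borel \<Otimes>\<^sub>M borel \<rightarrow>\<^sub>M prob_algebra borel"
    and mu_kernel: "\<mu> \<in> borel \<rightarrow>\<^sub>M prob_algebra borel"
    and mu_invariant:
      "\<And>y A. A \<in> sets borel \<Longrightarrow> (\<integral>\<^sup>+ z. emeasure (PX z y) A \<partial>\<mu> y) = emeasure (\<mu> (path_shift y)) A"
    and PY_prob: "PY \<in> space (prob_algebra borel)"
    and PY_invariant: "distr PY borel path_shift = PY"
  shows
    "let merging =
           (AE (z, z', y) in pair_mixture \<mu> PY.
              (\<lambda>n. tv_norm_diff (quenched_marginal PX z y n) (quenched_marginal PX z' y n))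
                \<longlonglongrightarrow> 0);
         tail_trivial =
           (\<exists>H\<in>sets borel. emeasure (pair_mixture \<mu> PY) H = 1 \<and>
              (\<forall>A\<in>tail_field. \<forall>(z, z', y)\<in>H.
                 measure (quenched PX z y) A = (measure (quenched PX z y) A)\<^sup>2 \<and>
                 (measure (quenched PX z y) A)\<^sup>2 = measure (quenched PX z' y) A));
         nonsingular =
           (AE (z, z', y) in pair_mixture \<mu> PY.
              \<exists>n::nat. \<not> mutually_singular
                 (quenched_marginal PX z y n) (quenched_marginal PX z' y n))
     in (merging \<longleftrightarrow> tail_trivial) \<and> (tail_trivial \<longleftrightarrow> nonsingular)"
proof -
  interpret stationary_environment PX \<mu> PY
    by unfold_locales (fact PX_kernel mu_kernel PY_prob PY_invariant mu_invariant)+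
  interpret st: prob_space "pair_mixture \<mu> PY"
    using stationary_law_in_prob_algebra by (simp add: space_prob_algebra)
  have sets_st: "sets (pair_mixture \<mu> PY) = sets borel"
    using stationary_law_in_prob_algebra by (simp add: space_prob_algebra)
  have tv: "tv_norm_diff (quenched_marginal PX z y n) (quenched_marginal PX z' y n) = 2 * merge_gap n z z' y"
    for z z' y n
    unfolding merge_gap_def
    by (rule tv_norm_diff_eq_set_gap[OF prob_space_marginal prob_space_marginal]) (simp add: sets_marginal)
  have sing: "mutually_singular (quenched_marginal PX z y n) (quenched_marginal PX z' y n)
      \<longleftrightarrow> merge_gap n z z' y = 1" for z z' y n
    unfolding merge_gap_def
    by (rule mutually_singular_iff_set_gap[OF prob_space_marginal prob_space_marginal]) (simp add: sets_marginal)
  \<comment> \<open>The three statements become predicates of one starting point. Tail triviality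
    implies merging, and merging implies non-singularity, at every point; only the way back from
    non-singularity uses the almost sure constancy of \<beta>.\<close>
  define merging where "merging z z' y \<longleftrightarrow>
    (\<lambda>n. tv_norm_diff (quenched_marginal PX z y n) (quenched_marginal PX z' y n)) \<longlonglongrightarrow> 0" for z z' y
  define trivial where "trivial z z' y \<longleftrightarrow> (\<forall>A\<in>tail_field.
    measure (quenched PX z y) A = (measure (quenched PX z y) A)\<^sup>2 \<and>
    (measure (quenched PX z y) A)\<^sup>2 = measure (quenched PX z' y) A)" for z z' y
  define nonsingular where "nonsingular z z' y \<longleftrightarrow>
    (\<exists>n::nat. \<not> mutually_singular (quenched_marginal PX z y n) (quenched_marginal PX z' y n))" for z z' y
  have merging_iff: "merging z z' y \<longleftrightarrow> merge_limit z z' y = 0" for z z' y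
  proof
    assume "merging z z' y"
    then have "(\<lambda>n. (1 / 2) * (2 * merge_gap n z z' y)) \<longlonglongrightarrow> (1 / 2) * 0"
      unfolding merging_def tv by (rule tendsto_mult_left)
    then show "merge_limit z z' y = 0"
      using LIMSEQ_unique[OF merge_gap_tendsto] by simp
  next
    assume "merge_limit z z' y = 0"
    then have "(\<lambda>n. 2 * merge_gap n z z' y) \<longlonglongrightarrow> 2 * 0"
      using merge_gap_tendsto[of z z' y] by (intro tendsto_mult_left) simp
    then show "merging z z' y" unfolding merging_def tv by simp
  qed
  have nonsingular_iff: "nonsingular z z' y \<longleftrightarrow> merge_limit z z' y < 1" for z z' y
  proof
    assume "nonsingular z z' y"
    then obtain n where "merge_gap n z z' y \<noteq> 1" by (auto simp: nonsingular_def sing)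
    then show "merge_limit z z' y < 1"
      using merge_gap_le_1[of n z z' y] merge_limit_le[of z z' y n] by linarith
  next
    assume "merge_limit z z' y < 1"
    then have "\<forall>\<^sub>F n in sequentially. merge_gap n z z' y < 1"
      by (rule order_tendstoD(2)[OF merge_gap_tendsto])
    then obtain n where "merge_gap n z z' y < 1" by (auto simp: eventually_sequentially)
    then show "nonsingular z z' y" unfolding nonsingular_def sing by (intro exI[of _ n]) simp
  qed
  have trivial_merging: "merging z z' y" if "trivial z z' y" for z z' y
    unfolding merging_iff by (rule merge_limit_eq_0) (use that in \<open>auto simp: trivial_def\<close>)
  have merging_nonsingular: "nonsingular z z' y" if "merging z z' y" for z z' y
    using that unfolding merging_iff nonsingular_iff by simp
  have nonsingular_trivial: "trivial z z' y"
    if ns: "nonsingular z z' y" and const: "\<forall>n. AE v in pair_kernel n (z, z', y).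
      triple_merge_limit v = triple_merge_limit (z, z', y)" for z z' y
    unfolding trivial_def
  proof
    fix A :: "(int \<Rightarrow> 'e) set" assume A: "A \<in> tail_field"
    have compl: "measure (quenched PX v y) (- A) = 1 - measure (quenched PX v y) A" for v
      using prob_space.prob_compl[OF prob_space_law, of A v y] sets_tail_field[OF A, of 0]
      by (simp add: sets_law Compl_eq_Diff_UNIV)
    \<comment> \<open>The alternative for \<open>A\<close> excludes (1, 0) as well as intermediate
      values unless one side is extreme; together with the alternative for the complement, only both
      probabilities 0 or both 1 remain.\<close>
    have "measure (quenched PX z y) A = 0 \<or> measure (quenched PX z' y) A = 1"
      "measure (quenched PX z y) (- A) = 0 \<or> measure (quenched PX z' y) (- A) = 1"
      using ns unfolding nonsingular_iff
      by (intro tail_zero_one const[rule_format] A Compl_tail_field[OF A]; assumption)+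
    then show "measure (quenched PX z y) A = (measure (quenched PX z y) A)\<^sup>2 \<and>
        (measure (quenched PX z y) A)\<^sup>2 = measure (quenched PX z' y) A"
      unfolding compl by auto
  qed
  \<comment> \<open>In \<open>trivial\<close> the quantifier over tail events stands inside the
    almost sure statement, so the complement of a single measurable null set serves as the
    event-independent \<open>H\<close>.\<close>
  have tail_iff: "(\<exists>H\<in>sets borel. emeasure (pair_mixture \<mu> PY) H = 1 \<and>
      (\<forall>A\<in>tail_field. \<forall>(z, z', y)\<in>H.
         measure (quenched PX z y) A = (measure (quenched PX z y) A)\<^sup>2 \<and>
         (measure (quenched PX z y) A)\<^sup>2 = measure (quenched PX z' y) A))
    \<longleftrightarrow> (AE (z, z', y) in pair_mixture \<mu> PY. trivial z z' y)" (is "?T \<longleftrightarrow> ?A")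
  proof
    assume ?T
    then obtain H where H: "H \<in> sets borel" "emeasure (pair_mixture \<mu> PY) H = 1"
      and triv: "\<And>z z' y. (z, z', y) \<in> H \<Longrightarrow> trivial z z' y"
      unfolding trivial_def by blast
    have "AE w in pair_mixture \<mu> PY. w \<in> H"
      using H by (intro st.AE_prob_1) (simp add: measure_def)
    then show ?A by eventually_elim (auto intro: triv)
  next
    assume ?A
    then obtain N where N: "{w \<in> space (pair_mixture \<mu> PY). \<not> (case w of (z, z', y) \<Rightarrow> trivial z z' y)} \<subseteq> N"
      "emeasure (pair_mixture \<mu> PY) N = 0" "N \<in> sets (pair_mixture \<mu> PY)"
      by (rule AE_E)
    have sp: "space (pair_mixture \<mu> PY) = UNIV" using sets_eq_imp_space_eq[OF sets_st] by simp
    have "emeasure (pair_mixture \<mu> PY) (space (pair_mixture \<mu> PY) - N) = 1"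
      using N by (subst emeasure_compl) (auto simp: st.emeasure_space_1)
    moreover have "trivial z z' y" if "(z, z', y) \<in> space (pair_mixture \<mu> PY) - N" for z z' y
      using N(1) that by blast
    ultimately show ?T
      using N(3) by (intro bexI[of _ "space (pair_mixture \<mu> PY) - N"]) (auto simp: trivial_def sets_st sp)
  qed
  have 1: "(AE (z, z', y) in pair_mixture \<mu> PY. merging z z' y)"
    if "AE (z, z', y) in pair_mixture \<mu> PY. trivial z z' y"
    using that by eventually_elim (auto intro: trivial_merging)
  have 2: "(AE (z, z', y) in pair_mixture \<mu> PY. nonsingular z z' y)"
    if "AE (z, z', y) in pair_mixture \<mu> PY. merging z z' y"
    using that by eventually_elim (auto intro: merging_nonsingular)
  have 3: "(AE (z, z', y) in pair_mixture \<mu> PY. trivial z z' y)"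
    if "AE (z, z', y) in pair_mixture \<mu> PY. nonsingular z z' y"
    using that AE_merge_limit_const by eventually_elim (auto intro: nonsingular_trivial)
  show ?thesis
    unfolding Let_def tail_iff merging_def[symmetric] nonsingular_def[symmetric]
    using 1 2 3 by blast
qed

end
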